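(* Let $1<p<\infty$, $0<s<1$ and let $\Omega\subsetneq\mathbb{R}^N$ be an open set whose boundary is locally continuous at some point $x_0\in\partial\Omega$. Suppose that there exist a positive local weak supersolution $u$ of \[ (-\Delta_p)^s u=\lambda\,\frac{|u|^{p-2}u}{d_\Omega^{s\,p}}\quad\text{in }\Omega,\qquad\text{with }\lambda=\mathfrak{h}_{s,p}(\Omega), \] and a constant $C>0$ such that \[ u\ge\frac1C\,d_\Omega^{\frac{s\,p-1}{p}}\quad\text{in }\Omega. \] Then the infimum $\mathfrak{h}_{s,p}(\Omega)$ is not attained, i.e. there is no $v\in\widetilde W^{s,p}_0(\Omega)$ with $\int_\Omega|v|^p d_\Omega^{-s\,p}\,dx=1$ and $[v]^p_{W^{s,p}(\mathbb{R}^N)}=\mathfrak{h}_{s,p}(\Omega)$.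
   Context: $d_\Omega(x)=\min_{y\in\partial\Omega}|x-y|$ for $x\in\Omega$; $J_p(t)=|t|^{p-2}t$. For open $E\subset\mathbb{R}^N$, $[u]_{W^{s,p}(E)}=\left(\iint_{E\times E}\frac{|u(x)-u(y)|^p}{|x-y|^{N+s\,p}}dx\,dy\right)^{1/p}$ and $W^{s,p}(E)=\{u\in L^p(E):[u]_{W^{s,p}(E)}<\infty\}$, normed by $\|u\|_{L^p(E)}+[u]_{W^{s,p}(E)}$. $W^{s,p}_{\rm loc}(\Omega)$ is the set of $u\in L^p_{\rm loc}(\Omega)$ belonging to $W^{s,p}(\Omega')$ for every open $\Omega'$ with $\overline{\Omega'}$ compact and contained in $\Omega$. $\widetilde W^{s,p}_0(\Omega)$ is the closure of $C^\infty_0(\Omega)$ (smooth functions compactly supported in $\Omega$, extended by $0$) in $W^{s,p}(\mathbb{R}^N)$. $L^{p-1}_{s\,p}(\mathbb{R}^N)$ is the set of $u\in L^{p-1}_{\rm loc}(\mathbb{R}^N)$ with $\int_{\mathbb{R}^N}\frac{|u(x)|^{p-1}}{(1+|x|)^{N+s\,p}}dx<\infty$. \[ \mathfrak{h}_{s,p}(\Omega)=\inf_{u\in C^\infty_0(\Omega)}\left\{[u]^p_{W^{s,p}(\mathbb{R}^N)}:\int_\Omega\frac{|u|^p}{d_\Omega^{s\,p}}dx=1\right\}, \] which equals the same infimum over $\widetilde W^{s,p}_0(\Omega)$. A function $u\in W^{s,p}_{\rm loc}(\Omega)\cap L^{p-1}_{s\,p}(\mathbb{R}^N)$ is a local weak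 supersolution of $(-\Delta_p)^su=\lambda|u|^{p-2}u/d_\Omega^{s\,p}$ in $\Omega$ if \[ \iint_{\mathbb{R}^N\times\mathbb{R}^N}\frac{J_p(u(x)-u(y))(\varphi(x)-\varphi(y))}{|x-y|^{N+s\,p}}dx\,dy\ge\lambda\int_\Omega\frac{|u|^{p-2}u}{d_\Omega^{s\,p}}\,\varphi\,dx \] for every non-negative $\varphi\in W^{s,p}(\mathbb{R}^N)$ with compact support in $\Omega$. Such a $u$ (a function on $\mathbb{R}^N$) is called positive if $u\ge 0$ in $\mathbb{R}^N$ and $u>0$ in $\Omega$; it is not required to vanish outside $\Omega$. The boundary $\partial\Omega$ is locally continuous at $x_0\in\partial\Omega$ if there exist $\delta_0,\delta_1>0$, an isometry $\mathcal{O}:\mathbb{R}^N\to\mathbb{R}^N$ with $\mathcal{O}(x_0)=0$, and a continuous function $\Psi:(-\delta_0,\delta_0)^{N-1}\to(-\delta_1,\delta_1)$ such that, with $Q=(-\delta_0,\delta_0)^{N-1}\times(-\delta_1,\delta_1)$, \[ Q\cap\mathcal{O}(\Omega)=\{(x',x_N)\in Q:\Psi(x')<x_N<\delta_1\},\qquad Q\cap\mathcal{O}(\partial\Omega)=\{(x',x_N)\in Q:x_N=\Psi(x')\}. \] *)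

theory Defs
  imports "HOL-Analysis.Analysis"
begin

text \<open>
  The Euclidean space of dimension N is an arbitrary type \<open>'a\<close> of class
  \<^class>\<open>euclidean_space\<close>, with N = \<open>DIM('a)\<close>. Elements of Lebesgue and Sobolev
  spaces are represented by Lebesgue measurable functions; pointwise relations between
  them are understood almost everywhere. Double integrals are integrals with respect to
  the Lebesgue measure on \<open>'a \<times> 'a\<close>. Integrals of nonnegative functions take values in
  \<^typ>\<open>ennreal\<close>.
\<close>

definition J :: "real \<Rightarrow> real \<Rightarrow> real" where
  "J p t = \<bar>t\<bar> powr (p - 2) * t"

definition bdist :: "'a::euclidean_space set \<Rightarrow> 'a \<Rightarrow> real" where
  "bdist \<Omega> x = infdist x (frontier \<Omega>)"


subsection \<open>Smooth functions with compact support\<close>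

primrec Ck :: "nat \<Rightarrow> ('a::euclidean_space \<Rightarrow> real) \<Rightarrow> bool" where
  "Ck 0 f \<longleftrightarrow> continuous_on UNIV f"
| "Ck (Suc k) f \<longleftrightarrow> (\<forall>x. f differentiable (at x)) \<and>
     (\<forall>b\<in>Basis. Ck k (\<lambda>x. frechet_derivative f (at x) b))"

definition Cc_infinity :: "'a::euclidean_space set \<Rightarrow> ('a \<Rightarrow> real) set" where
  "Cc_infinity \<Omega> = {f. (\<forall>k. Ck k f) \<and>
     compact (closure {x. f x \<noteq> 0}) \<and> closure {x. f x \<noteq> 0} \<subseteq> \<Omega>}"


subsection \<open>Fractional Sobolev spaces\<close>

text \<open>The p-th power of the Gagliardo seminorm.\<close>

definition gagliardo :: "real \<Rightarrow> real \<Rightarrow> 'a::euclidean_space set \<Rightarrow> ('a \<Rightarrow> real) \<Rightarrow> ennreal" where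
  "gagliardo s p E u =
     (\<integral>\<^sup>+z\<in>E \<times> E. ennreal (\<bar>u (fst z) - u (snd z)\<bar> powr p /
        norm (fst z - snd z) powr (real DIM('a) + s * p)) \<partial>lebesgue)"

definition Lp_int :: "real \<Rightarrow> 'a::euclidean_space set \<Rightarrow> ('a \<Rightarrow> real) \<Rightarrow> ennreal" where
  "Lp_int p E u = (\<integral>\<^sup>+x\<in>E. ennreal (\<bar>u x\<bar> powr p) \<partial>lebesgue)"

definition Wsp :: "real \<Rightarrow> real \<Rightarrow> 'a::euclidean_space set \<Rightarrow> ('a \<Rightarrow> real) set" where
  "Wsp s p E = {u. u \<in> borel_measurable (lebesgue_on E) \<and>
     Lp_int p E u < \<infinity> \<and> gagliardo s p E u < \<infinity>}"

text \<open>The norm below is meaningful for elements of \<^const>\<open>Wsp\<close>, where both integrals are finite.\<close>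

definition Wsp_norm :: "real \<Rightarrow> real \<Rightarrow> 'a::euclidean_space set \<Rightarrow> ('a \<Rightarrow> real) \<Rightarrow> real" where
  "Wsp_norm s p E u =
     enn2real (Lp_int p E u) powr (1 / p) + enn2real (gagliardo s p E u) powr (1 / p)"

definition Lp_loc :: "real \<Rightarrow> 'a::euclidean_space set \<Rightarrow> ('a \<Rightarrow> real) set" where
  "Lp_loc q \<Omega> = {u. u \<in> borel_measurable (lebesgue_on \<Omega>) \<and>
     (\<forall>K. compact K \<and> K \<subseteq> \<Omega> \<longrightarrow> Lp_int q K u < \<infinity>)}"

definition Wsp_loc :: "real \<Rightarrow> real \<Rightarrow> 'a::euclidean_space set \<Rightarrow> ('a \<Rightarrow> real) set" where
  "Wsp_loc s p \<Omega> = {u \<in> Lp_loc p \<Omega>.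
     \<forall>\<Omega>'. open \<Omega>' \<and> compact (closure \<Omega>') \<and> closure \<Omega>' \<subseteq> \<Omega> \<longrightarrow> u \<in> Wsp s p \<Omega>'}"

definition Wsp_tilde0 :: "real \<Rightarrow> real \<Rightarrow> 'a::euclidean_space set \<Rightarrow> ('a \<Rightarrow> real) set" where
  "Wsp_tilde0 s p \<Omega> = {v \<in> Wsp s p UNIV.
     \<forall>\<epsilon>>0. \<exists>\<phi>\<in>Cc_infinity \<Omega>. Wsp_norm s p UNIV (\<lambda>x. v x - \<phi> x) < \<epsilon>}"

text \<open>The tail space, with integrability exponent \<open>p - 1\<close> and weight exponent \<open>N + s p\<close>.\<close>

definition Lsp_tail :: "real \<Rightarrow> real \<Rightarrow> ('a::euclidean_space \<Rightarrow> real) set" where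
  "Lsp_tail s p = {u \<in> Lp_loc (p - 1) UNIV.
     (\<integral>\<^sup>+x. ennreal (\<bar>u x\<bar> powr (p - 1) / (1 + norm x) powr (real DIM('a) + s * p)) \<partial>lebesgue)
       < \<infinity>}"


subsection \<open>The sharp Hardy constant and supersolutions\<close>

definition hardy_int :: "real \<Rightarrow> real \<Rightarrow> 'a::euclidean_space set \<Rightarrow> ('a \<Rightarrow> real) \<Rightarrow> ennreal" where
  "hardy_int s p \<Omega> u =
     (\<integral>\<^sup>+x\<in>\<Omega>. ennreal (\<bar>u x\<bar> powr p / bdist \<Omega> x powr (s * p)) \<partial>lebesgue)"

definition hardy_const :: "real \<Rightarrow> real \<Rightarrow> 'a::euclidean_space set \<Rightarrow> ennreal" where
  "hardy_const s p \<Omega> =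
     Inf {gagliardo s p UNIV u | u. u \<in> Cc_infinity \<Omega> \<and> hardy_int s p \<Omega> u = 1}"

text \<open>
  For \<open>u\<close> in the spaces required below and admissible \<open>\<phi>\<close>, both integrands in the weak
  inequality are absolutely integrable, so the Bochner integrals are the genuine ones.
\<close>

definition local_weak_supersolution ::
    "real \<Rightarrow> real \<Rightarrow> real \<Rightarrow> 'a::euclidean_space set \<Rightarrow> ('a \<Rightarrow> real) \<Rightarrow> bool" where
  "local_weak_supersolution s p lam \<Omega> u \<longleftrightarrow>
     u \<in> Wsp_loc s p \<Omega> \<and> u \<in> Lsp_tail s p \<and>
     (\<forall>\<phi>\<in>Wsp s p UNIV.
        (AE x in lebesgue. \<phi> x \<ge> 0) \<and>
        (\<exists>K. compact K \<and> K \<subseteq> \<Omega> \<and> (AE x in lebesgue. x \<notin> K \<longrightarrow> \<phi> x = 0)) \<longrightarrow>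
        (LINT z|lebesgue. J p (u (fst z) - u (snd z)) * (\<phi> (fst z) - \<phi> (snd z)) /
             norm (fst z - snd z) powr (real DIM('a) + s * p))
        \<ge> lam * (LINT x:\<Omega>|lebesgue. \<bar>u x\<bar> powr (p - 2) * u x / bdist \<Omega> x powr (s * p) * \<phi> x))"

definition positive_on :: "'a::euclidean_space set \<Rightarrow> ('a \<Rightarrow> real) \<Rightarrow> bool" where
  "positive_on \<Omega> u \<longleftrightarrow>
     (AE x in lebesgue. u x \<ge> 0) \<and> (AE x in lebesgue. x \<in> \<Omega> \<longrightarrow> u x > 0)"


subsection \<open>Locally continuous boundary\<close>

text \<open>
  A basis vector \<open>e\<close> plays the role of the N-th coordinate direction (which one is
  immaterial, as the isometry may permute coordinates), so that \<open>x \<bullet> e\<close> is the last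
  coordinate of \<open>x\<close>, and \<open>x'\<close> is identified with \<open>x - (x \<bullet> e) *\<^sub>R e\<close>.
\<close>

definition base_cube :: "'a::euclidean_space \<Rightarrow> real \<Rightarrow> 'a set" where
  "base_cube e \<delta>\<^sub>0 = {z. z \<bullet> e = 0 \<and> (\<forall>b\<in>Basis - {e}. \<bar>z \<bullet> b\<bar> < \<delta>\<^sub>0)}"

definition cylinder :: "'a::euclidean_space \<Rightarrow> real \<Rightarrow> real \<Rightarrow> 'a set" where
  "cylinder e \<delta>\<^sub>0 \<delta>\<^sub>1 = {x. x - (x \<bullet> e) *\<^sub>R e \<in> base_cube e \<delta>\<^sub>0 \<and> \<bar>x \<bullet> e\<bar> < \<delta>\<^sub>1}"

definition locally_continuous_boundary_at :: "'a::euclidean_space set \<Rightarrow> 'a \<Rightarrow> bool" where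
  "locally_continuous_boundary_at \<Omega> x\<^sub>0 \<longleftrightarrow>
     (\<exists>e\<in>Basis. \<exists>\<delta>\<^sub>0>0. \<exists>\<delta>\<^sub>1>0. \<exists>(O' :: 'a \<Rightarrow> 'a) (\<Psi> :: 'a \<Rightarrow> real).
        (\<forall>x y. dist (O' x) (O' y) = dist x y) \<and> O' x\<^sub>0 = 0 \<and>
        continuous_on (base_cube e \<delta>\<^sub>0) \<Psi> \<and> \<Psi> ` base_cube e \<delta>\<^sub>0 \<subseteq> {-\<delta>\<^sub>1<..<\<delta>\<^sub>1} \<and>
        cylinder e \<delta>\<^sub>0 \<delta>\<^sub>1 \<inter> O' ` \<Omega> =
          {x \<in> cylinder e \<delta>\<^sub>0 \<delta>\<^sub>1. \<Psi> (x - (x \<bullet> e) *\<^sub>R e) < x \<bullet> e \<and> x \<bullet> e < \<delta>\<^sub>1} \<and>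
        cylinder e \<delta>\<^sub>0 \<delta>\<^sub>1 \<inter> O' ` frontier \<Omega> =
          {x \<in> cylinder e \<delta>\<^sub>0 \<delta>\<^sub>1. x \<bullet> e = \<Psi> (x - (x \<bullet> e) *\<^sub>R e)})"

end

theory Submission
  imports Defs
begin

text \<open>
  Suppose that a minimiser \<open>v\<close> exists. The engine of the proof is the discrete Picone inequality: for
  \<open>\<alpha>, \<beta> > 0\<close> the quantity
  \[ |a-b|^p - J_p(\alpha-\beta)\left(\frac{|a|^p}{\alpha^{p-1}} - \frac{|b|^p}{\beta^{p-1}}\right) \]
  is nonnegative, and it vanishes only if \<open>|a| / \<alpha> = |b| / \<beta>\<close> (lemmas \<open>picone_nonneg\<close> and
  \<open>picone_pos\<close>). Take \<open>\<psi>\<close> smooth with compact support and test the supersolution \<open>u\<close> with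
  \<open>|\<psi>|\<^sup>p / (u + \<epsilon>)\<^sup>p\<^sup>-\<^sup>1\<close>. The Gagliardo energy of \<open>\<psi>\<close> then bounds
  the double integral of the Picone defect of \<open>(\<psi>, u + \<epsilon>)\<close> plus \<open>\<lambda>\<close> times a
  Hardy integral of \<open>\<psi>\<close> with a weight that increases to 1 as \<open>\<epsilon> \<rightarrow> 0\<close>
  (\<open>supersolution_picone_inequality\<close>).

  Let \<open>\<psi>\<close> run through a sequence that converges to \<open>v\<close> almost everywhere, with energies that
  exceed that of \<open>v\<close> by a vanishing amount at most, and let \<open>\<epsilon> \<rightarrow> 0\<close>. Fatou's lemma, applied to both terms on the left, gives that the integral of
  the Picone defect of \<open>(v, u)\<close> over \<open>\<Omega> \<times> \<Omega>\<close> plus \<open>\<lambda>\<close> is at most the energy of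
  \<open>v\<close>, which is \<open>\<lambda>\<close>. So the defect vanishes, and \<open>|v| = k u\<close> in \<open>\<Omega>\<close> with one constant
  \<open>k > 0\<close>. The constant is the same on all components of \<open>\<Omega>\<close>, because the defect compares all
  pairs of points (\<open>minimiser_proportional_to_supersolution\<close>, \<open>ae_constant_from_pairs\<close>).

  The lower bound on \<open>u\<close> now forces \<open>|v|\<^sup>p / d\<^sup>s\<^sup>p\<close> to be at least a positive multiple of
  \<open>1 / d\<close>. Near a boundary point where \<open>\<Omega>\<close> is the epigraph of a continuous function, \<open>d\<close> is at
  most the vertical height above the graph, and the layers at height between \<open>t/2\<close> and \<open>t\<close> have
  measure proportional to \<open>t\<close>. Hence \<open>1 / d\<close> is not integrable
  (\<open>nn_integral_reciprocal_bdist_infinite\<close>), which contradicts the normalisation of \<open>v\<close>.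
\<close>

section \<open>The discrete Picone inequality\<close>

text \<open>
  By the mean value theorem, since the derivative \<open>p t\<^sup>p\<^sup>-\<^sup>1\<close> is strictly increasing.
\<close>

lemma powr_above_tangent:
  fixes p m x :: real
  assumes "1 < p" "0 < m" "0 \<le> x" "x \<noteq> m"
  shows "m powr p + p * m powr (p - 1) * (x - m) < x powr p"
proof -
  have der: "((\<lambda>t. t powr p) has_real_derivative p * t powr (p - 1)) (at t)" if "t > 0" for t
    using that by (auto intro!: derivative_eq_intros)
  have cont: "continuous_on A (\<lambda>t. t powr p)" if "A \<subseteq> {0..}" for A
    using that assms(1) by (intro continuous_on_powr' continuous_intros) auto
  show ?thesis
  proof (cases "m < x")
    case True
    obtain z where z: "m < z" "z < x" "x powr p - m powr p = (x - m) * (p * z powr (p - 1))"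
      using MVT2[OF True, of "\<lambda>t. t powr p" "\<lambda>t. p * t powr (p - 1)"] der assms
      by (meson less_le_trans)
    have "m powr (p - 1) < z powr (p - 1)" using z assms by (intro powr_less_mono2) auto
    then have "(x - m) * (p * m powr (p - 1)) < (x - m) * (p * z powr (p - 1))"
      using True assms by simp
    then show ?thesis using z(3) by (simp add: algebra_simps)
  next
    case False
    then have less: "x < m" using assms by simp
    have diff: "(\<lambda>t. t powr p) differentiable (at t)" if "x < t" "t < m" for t
      using der[of t] that assms real_differentiable_def by fastforce
    have "continuous_on {x..m} (\<lambda>t. t powr p)" using assms by (intro cont) auto
    then obtain l z where z: "x < z" "z < m" "DERIV (\<lambda>t. t powr p) z :> l" 
        "m powr p - x powr p = (m - x) * l"
      using MVT[OF less] diff by metis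
    have l: "l = p * z powr (p - 1)" using DERIV_unique[OF z(3) der] z assms by simp
    have "z powr (p - 1) < m powr (p - 1)" using z assms by (intro powr_less_mono2) auto
    then have "(m - x) * (p * z powr (p - 1)) < (m - x) * (p * m powr (p - 1))"
      using less assms by simp
    then show ?thesis using z(4) l by (simp add: algebra_simps)
  qed
qed

text \<open>
  Strict convexity of \<open>x\<^sup>p\<close>: the point \<open>a + b\<close> is the mean, with weights \<open>1 - t\<close> and \<open>t\<close>, of
  \<open>a / (1 - t)\<close> and \<open>b / t\<close>, and these two points differ exactly when \<open>t a \<noteq> (1 - t) b\<close>.
\<close>

lemma powr_add_less:
  fixes a b p t :: real
  assumes "1 < p" "0 < t" "t < 1" "0 \<le> a" "0 \<le> b" "t * a \<noteq> (1 - t) * b"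
  shows "(a + b) powr p < (1 - t) powr (1 - p) * a powr p + t powr (1 - p) * b powr p"
proof -
  define m where "m = a + b"
  have "a + b \<noteq> 0" using assms by (auto simp: add_nonneg_eq_0_iff)
  then have m: "m > 0" using assms unfolding m_def by linarith
  have 1: "a / (1 - t) \<noteq> m" using assms by (auto simp: m_def field_simps)
  have 2: "b / t \<noteq> m" using assms by (auto simp: m_def field_simps)
  have "(1 - t) * (m powr p + p * m powr (p - 1) * (a / (1 - t) - m)) < (1 - t) * (a / (1 - t)) powr p"
    using powr_above_tangent[OF assms(1) m _ 1] assms by simp
  moreover have "t * (m powr p + p * m powr (p - 1) * (b / t - m)) < t * (b / t) powr p"
    using powr_above_tangent[OF assms(1) m _ 2] assms by simp
  moreover have "(1 - t) * (m powr p + p * m powr (p - 1) * (a / (1 - t) - m))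
      + t * (m powr p + p * m powr (p - 1) * (b / t - m)) = 
      m powr p + p * m powr (p - 1) * ((1 - t) * (a / (1 - t)) + t * (b / t) - m)"
    by (simp add: algebra_simps)
  moreover have "(1 - t) * (a / (1 - t)) + t * (b / t) - m = 0" using assms by (simp add: m_def)
  moreover have "(1 - t) * (a / (1 - t)) powr p = (1 - t) powr (1 - p) * a powr p"
    using assms by (simp add: powr_divide powr_diff)
  moreover have "t * (b / t) powr p = t powr (1 - p) * b powr p"
    using assms by (simp add: powr_divide powr_diff)
  ultimately have "m powr p < (1 - t) powr (1 - p) * a powr p + t powr (1 - p) * b powr p"
    by simp
  then show ?thesis by (simp add: m_def)
qed

text \<open>
  As \<open>t \<rightarrow> 0\<close> the first factor tends to 1. This makes the inequality a substitute for the triangle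
  inequality in \<open>L\<^sup>p\<close> whenever \<open>b\<close> is a small perturbation.
\<close>

lemma powr_add_le:
  fixes a b p t :: real
  assumes "1 < p" "0 < t" "t < 1" "0 \<le> a" "0 \<le> b"
  shows "(a + b) powr p \<le> (1 - t) powr (1 - p) * a powr p + t powr (1 - p) * b powr p"
proof (cases "t * a = (1 - t) * b")
  case False
  then show ?thesis using powr_add_less[OF assms] by simp
next
  case True
  define m where "m = a + b"
  have a: "a = (1 - t) * m" and b: "b = t * m" and "0 \<le> m"
    using True assms by (auto simp: m_def algebra_simps)
  have "(1 - t) powr (1 - p) * a powr p = (1 - t) * m powr p"
    using assms \<open>0 \<le> m\<close> by (simp add: a powr_mult powr_diff)
  moreover have "t powr (1 - p) * b powr p = t * m powr p"
    using assms \<open>0 \<le> m\<close> by (simp add: b powr_mult powr_diff)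
  ultimately show ?thesis by (simp add: m_def[symmetric] algebra_simps)
qed

lemma powr_abs_add_le:
  fixes a b p :: real
  assumes "1 < p"
  shows "\<bar>a + b\<bar> powr p \<le> 2 powr (p - 1) * \<bar>a\<bar> powr p + 2 powr (p - 1) * \<bar>b\<bar> powr p"
proof -
  have "\<bar>a + b\<bar> powr p \<le> (\<bar>a\<bar> + \<bar>b\<bar>) powr p" using assms by (intro powr_mono2) auto
  also have "\<dots> \<le> (1/2) powr (1 - p) * \<bar>a\<bar> powr p + (1/2) powr (1 - p) * \<bar>b\<bar> powr p"
    using powr_add_le[OF assms, of "1/2" "\<bar>a\<bar>" "\<bar>b\<bar>"] by simp
  also have "(1/2) powr (1 - p) = 2 powr (p - 1)"
    using powr_minus_divide[of 2 "1 - p"] by (simp add: powr_divide)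
  finally show ?thesis .
qed

text \<open>
  The defect in the discrete Picone inequality. In the application \<open>a, b\<close> are the values of a test function
  at two points and \<open>\<alpha>, \<beta>\<close> those of a positive supersolution, so that the subtracted term is the density
  of the weak formulation tested with \<open>|a|\<^sup>p / \<alpha>\<^sup>p\<^sup>-\<^sup>1\<close>.
\<close>

definition picone :: "real \<Rightarrow> real \<Rightarrow> real \<Rightarrow> real \<Rightarrow> real \<Rightarrow> real" where
  "picone p a b \<alpha> \<beta> = \<bar>a - b\<bar> powr p -
     J p (\<alpha> - \<beta>) * (\<bar>a\<bar> powr p / \<alpha> powr (p - 1) - \<bar>b\<bar> powr p / \<beta> powr (p - 1))"

lemma J_nonneg_arg: "0 \<le> t \<Longrightarrow> J p t = t powr (p - 1)"
  using powr_add[of t "p - 2" 1] by (cases "t = 0") (auto simp: J_def)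

lemma J_minus: "J p (- t) = - J p t"
  by (simp add: J_def)

lemma picone_swap: "picone p b a \<beta> \<alpha> = picone p a b \<alpha> \<beta>"
  using J_minus[of p "\<alpha> - \<beta>"] by (simp add: picone_def abs_minus_commute algebra_simps)

text \<open>
  Dividing by \<open>\<alpha>\<^sup>p\<^sup>-\<^sup>1\<close> leaves the single parameter \<open>\<theta> = \<beta> / \<alpha>\<close>. If
  \<open>|b| \<le> |a|\<close>, the claim is strict convexity of \<open>x\<^sup>p\<close> for the sum \<open>|b| + (|a| - |b|)\<close> with weight \<open>t = 1 - \<theta>\<close>.
\<close>

lemma picone_pos_ordered:
  assumes "1 < p" "0 < \<beta>" "\<beta> \<le> \<alpha>" and ne: "\<bar>a\<bar> * \<beta> \<noteq> \<bar>b\<bar> * \<alpha>"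
  shows "0 < picone p a b \<alpha> \<beta>"
proof (cases "\<beta> = \<alpha>")
  case True
  then show ?thesis using assms by (auto simp: picone_def J_def)
next
  case False
  define \<theta> where "\<theta> = \<beta> / \<alpha>"
  have \<theta>: "0 < \<theta>" "\<theta> < 1" "1 - \<theta> = (\<alpha> - \<beta>) / \<alpha>"
    using False assms by (auto simp: \<theta>_def field_simps)
  have \<alpha>: "0 < \<alpha>" using assms by simp
  let ?A = "\<bar>a\<bar>" and ?B = "\<bar>b\<bar>"
  have Jeq: "J p (\<alpha> - \<beta>) = (1 - \<theta>) powr (p - 1) * \<alpha> powr (p - 1)"
    using \<alpha> \<theta> assms by (simp add: J_nonneg_arg powr_mult[symmetric])
  have "\<theta> powr (p - 1) * \<alpha> powr (p - 1) = \<beta> powr (p - 1)"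
    using \<alpha> assms by (subst powr_mult[symmetric]) (auto simp: \<theta>_def)
  then have \<beta>eq: "\<beta> powr (p - 1) = \<theta> powr (p - 1) * \<alpha> powr (p - 1)" ..
  have inv: "\<theta> powr (1 - p) = 1 / \<theta> powr (p - 1)"
    using powr_minus_divide[of \<theta> "p - 1"] by simp
  have cancel: "X * Y * (A / Y - B / (T * Y)) = X * (A - 1 / T * B)" if "Y > 0" "T > 0" for X Y T A B :: real
    using that by (simp add: field_simps)
  have eq: "J p (\<alpha> - \<beta>) * (?A powr p / \<alpha> powr (p - 1) - ?B powr p / \<beta> powr (p - 1))
     = (1 - \<theta>) powr (p - 1) * (?A powr p - \<theta> powr (1 - p) * ?B powr p)"
    unfolding Jeq \<beta>eq inv by (rule cancel) (use \<alpha> \<theta> in auto)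
  have "(1 - \<theta>) powr (p - 1) * (?A powr p - \<theta> powr (1 - p) * ?B powr p) < \<bar>a - b\<bar> powr p"
  proof (cases "?B \<le> ?A")
    case True
    have "(1 - \<theta>) * ?B \<noteq> (1 - (1 - \<theta>)) * (?A - ?B)"
      using ne \<alpha> by (auto simp: \<theta>_def field_simps)
    then have "(?B + (?A - ?B)) powr p < (1 - (1 - \<theta>)) powr (1 - p) * ?B powr p
        + (1 - \<theta>) powr (1 - p) * (?A - ?B) powr p"
      using \<theta> assms True by (intro powr_add_less) auto
    then have "?A powr p - \<theta> powr (1 - p) * ?B powr p < (1 - \<theta>) powr (1 - p) * (?A - ?B) powr p"
      by simp
    then have "(1 - \<theta>) powr (p - 1) * (?A powr p - \<theta> powr (1 - p) * ?B powr p)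
       < (1 - \<theta>) powr (p - 1) * ((1 - \<theta>) powr (1 - p) * (?A - ?B) powr p)"
      using \<theta>(2) by (intro mult_strict_left_mono) auto
    also have "\<dots> = (?A - ?B) powr p"
      using \<theta>(1,2) by (simp add: mult.assoc[symmetric] powr_add[symmetric])
    also have "\<dots> \<le> \<bar>a - b\<bar> powr p"
      using assms True by (intro powr_mono2) auto
    finally show ?thesis .
  next
    case False
    \<comment> \<open>Here \<open>|a| < |b| \<le> \<theta>\<^sup>(\<^sup>1\<^sup>-\<^sup>p\<^sup>)\<^sup>/\<^sup>p |b|\<close>, so the left side is negative.\<close>
    have "1 \<le> \<theta> powr (1 - p)"
      using \<theta> assms powr_mono2'[of "1 - p" \<theta> 1] by simp
    then have "?B powr p \<le> \<theta> powr (1 - p) * ?B powr p"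
      using mult_right_mono[of 1 "\<theta> powr (1 - p)" "?B powr p"] by simp
    moreover have "?A powr p < ?B powr p" using False assms by (intro powr_less_mono2) auto
    ultimately have "(1 - \<theta>) powr (p - 1) * (?A powr p - \<theta> powr (1 - p) * ?B powr p) < 0"
      using \<theta> by (intro mult_pos_neg) auto
    then show ?thesis by (meson less_le_trans powr_ge_zero)
  qed
  then show ?thesis by (simp add: picone_def eq)
qed

text \<open>
  If \<open>|a| = k \<alpha>\<close> and \<open>|b| = k \<beta>\<close>, then the subtracted term equals \<open>||a| - |b||\<^sup>p\<close>. The defect is
  not zero when \<open>a\<close> and \<open>b\<close> have opposite signs.
\<close>

lemma picone_nonneg_proportional:
  assumes "1 < p" "0 < \<alpha>" "0 < \<beta>" and eq: "\<bar>a\<bar> * \<beta> = \<bar>b\<bar> * \<alpha>"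
  shows "0 \<le> picone p a b \<alpha> \<beta>"
proof -
  define k where "k = \<bar>a\<bar> / \<alpha>"
  have a: "\<bar>a\<bar> = k * \<alpha>" and b: "\<bar>b\<bar> = k * \<beta>" and k: "0 \<le> k"
    using assms by (auto simp: k_def field_simps)
  have quot: "\<gamma> powr p / \<gamma> powr (p - 1) = \<gamma>" if "0 < \<gamma>" for \<gamma> :: real
    using that by (simp add: powr_diff)
  have "J p (\<alpha> - \<beta>) * (\<bar>a\<bar> powr p / \<alpha> powr (p - 1) - \<bar>b\<bar> powr p / \<beta> powr (p - 1))
    = k powr p * (J p (\<alpha> - \<beta>) * (\<alpha> - \<beta>))"
    using quot[OF assms(2)] quot[OF assms(3)] assms k
    unfolding a b powr_mult times_divide_eq_right[symmetric] by (simp add: algebra_simps)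
  also have "J p (\<alpha> - \<beta>) * (\<alpha> - \<beta>) = \<bar>\<alpha> - \<beta>\<bar> powr p"
  proof (cases "\<alpha> = \<beta>")
    case False
    then have "\<bar>\<alpha> - \<beta>\<bar> powr p = \<bar>\<alpha> - \<beta>\<bar> powr (p - 2) * \<bar>\<alpha> - \<beta>\<bar>\<^sup>2"
      by (simp add: powr_diff)
    then show ?thesis by (simp add: J_def power2_eq_square)
  qed (simp add: J_def)
  also have "k powr p * \<bar>\<alpha> - \<beta>\<bar> powr p = \<bar>\<bar>a\<bar> - \<bar>b\<bar>\<bar> powr p"
  proof -
    have "\<bar>\<bar>a\<bar> - \<bar>b\<bar>\<bar> = k * \<bar>\<alpha> - \<beta>\<bar>"
      using k by (simp add: a b abs_mult right_diff_distrib[symmetric])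
    then show ?thesis by (simp add: powr_mult)
  qed
  also have "\<dots> \<le> \<bar>a - b\<bar> powr p"
    using assms by (intro powr_mono2) auto
  finally show ?thesis by (simp add: picone_def)
qed

lemma picone_pos:
  assumes "1 < p" "0 < \<alpha>" "0 < \<beta>" "\<bar>a\<bar> * \<beta> \<noteq> \<bar>b\<bar> * \<alpha>"
  shows "0 < picone p a b \<alpha> \<beta>"
proof (cases "\<beta> \<le> \<alpha>")
  case True
  then show ?thesis using picone_pos_ordered assms by blast
next
  case False
  then have "0 < picone p b a \<beta> \<alpha>"
    using assms by (intro picone_pos_ordered) auto
  then show ?thesis by (simp add: picone_swap)
qed

lemma picone_nonneg:
  assumes "1 < p" "0 < \<alpha>" "0 < \<beta>"
  shows "0 \<le> picone p a b \<alpha> \<beta>"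
  using picone_pos[OF assms, of a b] picone_nonneg_proportional[OF assms, of a b] by fastforce

section \<open>Lebesgue measure on the product space\<close>

text \<open>
  Lebesgue measure on a product is the completion of the product measure, so Fubini for null sets is
  applied to the uncompleted measures.
\<close>

lemma AE_lebesgue_prodD:
  assumes "AE z in (lebesgue :: ('a::euclidean_space \<times> 'b::euclidean_space) measure). P z"
  shows "AE x in lebesgue. AE y in lebesgue. P (x, y)"
proof -
  have "AE z in (lborel \<Otimes>\<^sub>M lborel :: ('a \<times> 'b) measure). P z"
    unfolding lborel_prod using assms by (simp add: AE_completion_iff)
  then show ?thesis
    by (simp add: AE_completion_iff lborel_pair.AE_pair)
qed

lemma null_sets_lborel_Times:
  assumes "N \<in> null_sets (lborel :: 'a::euclidean_space measure)"
  shows "N \<times> UNIV \<in> null_sets (lborel :: ('a \<times> 'b::euclidean_space) measure)"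
    and "UNIV \<times> N \<in> null_sets (lborel :: ('b \<times> 'a) measure)"
proof -
  have 1: "N \<times> UNIV \<in> null_sets (lborel \<Otimes>\<^sub>M lborel :: ('a \<times> 'b) measure)"
    using assms
    by (intro null_setsI pair_measureI) (auto simp: lborel.emeasure_pair_measure_Times null_sets_def)
  show "N \<times> UNIV \<in> null_sets (lborel :: ('a \<times> 'b) measure)" 
    using 1 unfolding lborel_prod .
  have 2: "UNIV \<times> N \<in> null_sets (lborel \<Otimes>\<^sub>M lborel :: ('b \<times> 'a) measure)"
    using assms
    by (intro null_setsI pair_measureI) (auto simp: lborel.emeasure_pair_measure_Times null_sets_def)
  show "UNIV \<times> N \<in> null_sets (lborel :: ('b \<times> 'a) measure)" 
    using 2 unfolding lborel_prod .
qed

lemma borel_measurable_fst_snd_borel: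
  "fst \<in> borel_measurable (borel :: ('a::euclidean_space \<times> 'b::euclidean_space) measure)"
  "snd \<in> borel_measurable (borel :: ('a::euclidean_space \<times> 'b::euclidean_space) measure)"
  by (intro borel_measurable_continuous_onI linear_continuous_on bounded_linear_fst bounded_linear_snd)+

text \<open>
  A measurable map into a completion must pull null sets back to null sets; for the two projections
  these preimages are cylinders over null sets.
\<close>

lemma null_sets_distr_fst_snd:
  "null_sets lborel \<subseteq> null_sets (distr (lebesgue :: ('a::euclidean_space \<times> 'b::euclidean_space) measure) lborel fst)"
  "null_sets lborel \<subseteq> null_sets (distr (lebesgue :: ('b \<times> 'a) measure) lborel snd)"
proof -
  have eq: "fst -` N = N \<times> (UNIV :: 'b set)" "snd -` N = (UNIV :: 'b set) \<times> N" for N :: "'a set" 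
    by auto
  have "N \<in> null_sets (distr (lebesgue :: ('a \<times> 'b) measure) lborel fst)" if "N \<in> null_sets lborel" for N
    using null_sets_completionI[OF null_sets_lborel_Times(1)[OF that, where 'b='b]] that
    by (subst null_sets_distr_iff) (auto simp: eq(1) intro!: measurable_completion borel_measurable_fst_snd_borel)
  then show "null_sets lborel \<subseteq> null_sets (distr (lebesgue :: ('a \<times> 'b) measure) lborel fst)"
    by blast
  have "N \<in> null_sets (distr (lebesgue :: ('b \<times> 'a) measure) lborel snd)" if "N \<in> null_sets lborel" for N
    using null_sets_completionI[OF null_sets_lborel_Times(2)[OF that, where 'b='b]] that
    by (subst null_sets_distr_iff) (auto simp: eq(2) intro!: measurable_completion borel_measurable_fst_snd_borel)
  then show "null_sets lborel \<subseteq> null_sets (distr (lebesgue :: ('b \<times> 'a) measure) lborel snd)"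
    by blast
qed

lemma measurable_fst_lebesgue [measurable]:
  "fst \<in> (lebesgue :: ('a::euclidean_space \<times> 'b::euclidean_space) measure) \<rightarrow>\<^sub>M (lebesgue :: 'a measure)"
  by (intro completion.measurable_completion2 null_sets_distr_fst_snd measurable_completion)
    (simp add: borel_measurable_fst_snd_borel)

lemma measurable_snd_lebesgue [measurable]:
  "snd \<in> (lebesgue :: ('a::euclidean_space \<times> 'b::euclidean_space) measure) \<rightarrow>\<^sub>M (lebesgue :: 'b measure)"
  by (intro completion.measurable_completion2 null_sets_distr_fst_snd measurable_completion)
    (simp add: borel_measurable_fst_snd_borel)

lemma AE_lebesgue_fst:
  assumes "AE x in (lebesgue :: 'a::euclidean_space measure). P x"
  shows "AE z in (lebesgue :: ('a \<times> 'b::euclidean_space) measure). P (fst z)"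
proof -
  have "AE x in lborel. P x" using assms by (simp add: AE_completion_iff)
  then obtain N where N: "{x \<in> space lborel. \<not> P x} \<subseteq> N" "N \<in> null_sets lborel"
    by (auto elim!: AE_E simp: null_sets_def)
  have "AE z in (lborel :: ('a \<times> 'b) measure). P (fst z)"
    by (rule AE_I'[OF null_sets_lborel_Times(1)[OF N(2)]]) (use N in auto)
  then show ?thesis by (simp add: AE_completion_iff)
qed

lemma AE_lebesgue_snd:
  assumes "AE x in (lebesgue :: 'b::euclidean_space measure). P x"
  shows "AE z in (lebesgue :: ('a::euclidean_space \<times> 'b) measure). P (snd z)"
proof -
  have "AE x in lborel. P x" using assms by (simp add: AE_completion_iff)
  then obtain N where N: "{x \<in> space lborel. \<not> P x} \<subseteq> N" "N \<in> null_sets lborel"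
    by (auto elim!: AE_E simp: null_sets_def)
  have "AE z in (lborel :: ('a \<times> 'b) measure). P (snd z)"
    by (rule AE_I'[OF null_sets_lborel_Times(2)[OF N(2)]]) (use N in auto)
  then show ?thesis by (simp add: AE_completion_iff)
qed

text \<open>
  Almost every \<open>x\<close> in \<open>A\<close> works by Fubini, and \<open>A\<close> is not a null set.
\<close>

lemma ae_constant_from_pairs:
  fixes A :: "'a::euclidean_space set"
  assumes ae: "AE z in lebesgue. z \<in> A \<times> A \<longrightarrow> w (fst z) = w (snd z)"
    and A: "A \<in> sets lebesgue" "emeasure lebesgue A \<noteq> 0"
  shows "\<exists>x\<in>A. AE y in lebesgue. y \<in> A \<longrightarrow> w y = w x"
proof -
  have "AE x in lebesgue. AE y in lebesgue. (x, y) \<in> A \<times> A \<longrightarrow> w x = w y"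
    using AE_lebesgue_prodD[OF ae] by simp
  moreover have "\<not> (AE x in lebesgue. x \<notin> A)"
    using A by (subst AE_iff_null_sets[symmetric]) auto
  ultimately show ?thesis
  proof (rule_tac ccontr)
    assume *: "\<not> ?thesis" "AE x in lebesgue. AE y in lebesgue. (x, y) \<in> A \<times> A \<longrightarrow> w x = w y"
      "\<not> (AE x in lebesgue. x \<notin> A)"
    have "x \<notin> A" if "AE y in lebesgue. (x, y) \<in> A \<times> A \<longrightarrow> w x = w y" for x
    proof
      assume "x \<in> A"
      then have "AE y in lebesgue. y \<in> A \<longrightarrow> w y = w x" using that by (auto elim!: eventually_mono)
      then show False using *(1) \<open>x \<in> A\<close> by blast
    qed
    then have "AE x in lebesgue. x \<notin> A" using *(2) by (rule_tac eventually_mono) auto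
    then show False using *(3) by blast
  qed
qed

section \<open>Integrability of the singular kernel\<close>

lemma nn_integral_lborel_reflect:
  fixes g :: "'a::euclidean_space \<Rightarrow> ennreal"
  assumes [measurable]: "g \<in> borel_measurable borel"
  shows "(\<integral>\<^sup>+ y. g (x - y) \<partial>lborel) = (\<integral>\<^sup>+ y. g y \<partial>lborel)"
proof -
  have "(\<integral>\<^sup>+ y. g y \<partial>lborel) = (\<integral>\<^sup>+ y. g y \<partial>distr lborel borel (\<lambda>y. x + (-1) *\<^sub>R y))"
    by (subst lborel_affine[of "-1" x]) (auto simp: density_1)
  also have "\<dots> = (\<integral>\<^sup>+ y. g (x - y) \<partial>lborel)"
    by (subst nn_integral_distr) auto
  finally show ?thesis ..
qed

lemma nn_integral_difference_kernel:
  fixes g :: "'a::euclidean_space \<Rightarrow> ennreal"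
  assumes [measurable]: "g \<in> borel_measurable borel" "K \<in> sets borel"
  shows "(\<integral>\<^sup>+ z. indicator K (fst z) * g (fst z - snd z) \<partial>lborel) = emeasure lborel K * (\<integral>\<^sup>+ y. g y \<partial>lborel)"
    and "(\<integral>\<^sup>+ z. indicator K (snd z) * g (fst z - snd z) \<partial>lborel) = emeasure lborel K * (\<integral>\<^sup>+ y. g y \<partial>lborel)"
proof -
  have "(\<integral>\<^sup>+ z. indicator K (fst z) * g (fst z - snd z) \<partial>lborel)
      = (\<integral>\<^sup>+ x. (\<integral>\<^sup>+ y. indicator K x * g (x - y) \<partial>lborel) \<partial>lborel)"
    unfolding lborel_prod[symmetric] by (subst lborel.nn_integral_fst[symmetric]) auto
  also have "\<dots> = emeasure lborel K * (\<integral>\<^sup>+ y. g y \<partial>lborel)"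
    by (subst nn_integral_cmult) (auto simp: nn_integral_lborel_reflect nn_integral_multc)
  finally show "(\<integral>\<^sup>+ z. indicator K (fst z) * g (fst z - snd z) \<partial>lborel) = emeasure lborel K * (\<integral>\<^sup>+ y. g y \<partial>lborel)" .
  have [measurable]: "(\<lambda>y. g (- y)) \<in> borel_measurable borel" by measurable
  have inner: "(\<integral>\<^sup>+ x. g (x - y) \<partial>lborel) = (\<integral>\<^sup>+ y. g (- y) \<partial>lborel)" for y
    using nn_integral_lborel_reflect[of "\<lambda>y. g (- y)" y] by simp
  have "(\<integral>\<^sup>+ z. indicator K (snd z) * g (fst z - snd z) \<partial>lborel)
      = (\<integral>\<^sup>+ y. (\<integral>\<^sup>+ x. indicator K y * g (- (y - x)) \<partial>lborel) \<partial>lborel)"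
    unfolding lborel_prod[symmetric] by (subst lborel_pair.nn_integral_snd[symmetric]) auto
  also have "\<dots> = emeasure lborel K * (\<integral>\<^sup>+ y. g (- y) \<partial>lborel)"
    using inner by (simp add: nn_integral_cmult nn_integral_multc)
  also have "(\<integral>\<^sup>+ y. g (- y) \<partial>lborel) = (\<integral>\<^sup>+ y. g y \<partial>lborel)"
    using nn_integral_lborel_reflect[of g 0] by simp
  finally show "(\<integral>\<^sup>+ z. indicator K (snd z) * g (fst z - snd z) \<partial>lborel) = emeasure lborel K * (\<integral>\<^sup>+ y. g y \<partial>lborel)" .
qed

text \<open>
  The ball of radius \<open>2 r\<^sub>k\<close> has measure proportional to \<open>r\<^sub>k\<^sup>N\<close>, so the \<open>k\<close>-th ball contributes a
  multiple of \<open>q\<^sup>k\<close> and the contributions form a convergent geometric series. This replaces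
  integration in polar coordinates.
\<close>

lemma nn_integral_dyadic_balls_finite:
  fixes f :: "'a::euclidean_space \<Rightarrow> real" and r :: "nat \<Rightarrow> real"
  assumes "\<And>k. 0 < r k" "0 \<le> M" "0 \<le> q" "q < 1"
    and f: "\<And>z. f z \<le> 0 \<or> (\<exists>k. norm z \<le> 2 * r k \<and> f z \<le> M * q ^ k / r k ^ DIM('a))"
  shows "(\<integral>\<^sup>+ z. ennreal (f z) \<partial>lborel) < \<infinity>"
proof -
  let ?h = "\<lambda>k (z::'a). ennreal (M * q ^ k / r k ^ DIM('a)) * indicator (cball 0 (2 * r k)) z"
  have [measurable]: "cball (0::'a) (2 * r k) \<in> sets borel" for k by (intro borel_closed) auto
  let ?\<omega> = "unit_ball_vol (real DIM('a))"
  have "(\<integral>\<^sup>+ z. ennreal (f z) \<partial>lborel) \<le> (\<integral>\<^sup>+ z. (\<Sum>k. ?h k z) \<partial>lborel)"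
  proof (rule nn_integral_mono)
    fix z :: 'a
    show "ennreal (f z) \<le> (\<Sum>k. ?h k z)"
    proof (cases "f z \<le> 0")
      case True then show ?thesis by (simp add: ennreal_neg)
    next
      case False
      then obtain k where k: "norm z \<le> 2 * r k" "f z \<le> M * q ^ k / r k ^ DIM('a)" using f by metis
      have "ennreal (f z) \<le> ?h k z" using k by (simp add: ennreal_leI)
      also have "\<dots> = sum (\<lambda>k. ?h k z) {k}"
        by (simp only: sum.insert finite.emptyI empty_iff not_False_eq_True sum.empty add_0_right)
      also have "\<dots> \<le> (\<Sum>k. ?h k z)"
        by (rule sum_le_suminf) auto
      finally show ?thesis .
    qed
  qed
  also have "\<dots> = (\<Sum>k. \<integral>\<^sup>+ z. ?h k z \<partial>lborel)"
    by (rule nn_integral_suminf) measurable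
  also have "(\<lambda>k. \<integral>\<^sup>+ z. ?h k z \<partial>lborel) = (\<lambda>k. ennreal (M * ?\<omega> * 2 ^ DIM('a) * q ^ k))"
  proof
    fix k
    have "(\<integral>\<^sup>+ z. ?h k z \<partial>lborel) = ennreal (M * q ^ k / r k ^ DIM('a)) * ennreal (?\<omega> * (2 * r k) ^ DIM('a))"
      using assms(1)[of k] by (subst nn_integral_cmult_indicator) (auto simp: emeasure_cball)
    also have "\<dots> = ennreal (M * ?\<omega> * 2 ^ DIM('a) * q ^ k)"
      using assms(1)[of k] assms(2,3) by (subst ennreal_mult'[symmetric]) (auto simp: power_mult_distrib)
    finally show "(\<integral>\<^sup>+ z. ?h k z \<partial>lborel) = ennreal (M * ?\<omega> * 2 ^ DIM('a) * q ^ k)" .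
  qed
  also have "(\<Sum>k. ennreal (M * ?\<omega> * 2 ^ DIM('a) * q ^ k)) < \<infinity>"
    using assms by (subst suminf_ennreal2) (auto intro!: summable_mult summable_geometric)
  finally show ?thesis .
qed

lemma ex_dyadic_power:
  fixes t :: real
  assumes "1 \<le> t"
  shows "\<exists>k. 2 ^ k \<le> t \<and> t < 2 ^ Suc k"
proof -
  obtain n where "t < 2 ^ n" using real_arch_pow[of 2 t] by auto
  then have "\<exists>k. t < 2 ^ Suc k" by (metis assms not_le not0_implies_Suc power_0)
  then obtain k where k: "t < 2 ^ Suc k" "\<forall>j<k. \<not> t < 2 ^ Suc j" 
    using exists_least_iff[of "\<lambda>k. t < 2 ^ Suc k"] by auto
  then have "2 ^ k \<le> t" using assms by (cases k) (auto simp: not_less)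
  then show ?thesis using k by blast
qed

lemma nn_integral_norm_powr_origin:
  fixes \<sigma> R :: real
  assumes "0 < \<sigma>" "0 < R"
  shows "(\<integral>\<^sup>+ z. ennreal (indicator (cball 0 R) z * norm z powr (\<sigma> - DIM('a))) \<partial>(lborel :: 'a::euclidean_space measure)) < \<infinity>"
proof (rule nn_integral_dyadic_balls_finite[where r = "\<lambda>k. R / 2 ^ Suc k" and M = "R powr \<sigma>" and q = "2 powr (- \<sigma>)"])
  show "2 powr - \<sigma> < 1" using assms by (simp add: powr_less_one)
  fix z :: 'a
  show "indicator (cball 0 R) z * norm z powr (\<sigma> - DIM('a)) \<le> 0 \<or>
    (\<exists>k. norm z \<le> 2 * (R / 2 ^ Suc k) \<and>
       indicator (cball 0 R) z * norm z powr (\<sigma> - DIM('a))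
         \<le> R powr \<sigma> * (2 powr - \<sigma>) ^ k / (R / 2 ^ Suc k) ^ DIM('a))"
  proof (cases "z \<in> cball 0 R \<and> z \<noteq> 0")
    case True
    then have z: "0 < norm z" "norm z \<le> R" by auto
    obtain k where k: "2 ^ k \<le> R / norm z" "R / norm z < 2 ^ Suc k"
      using ex_dyadic_power[of "R / norm z"] z by auto
    have le: "norm z \<le> R / 2 ^ k" and ge: "R / 2 ^ Suc k \<le> norm z" using k z by (auto simp: field_simps)
    have "norm z powr \<sigma> \<le> (R / 2 ^ k) powr \<sigma>" using le assms by (intro powr_mono2) auto
    also have "\<dots> = R powr \<sigma> * (2 powr - \<sigma>) ^ k"
      using assms
      by (simp add: powr_divide powr_minus_divide powr_realpow[symmetric] powr_powr mult.commute power_one_over)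
    finally have 1: "norm z powr \<sigma> \<le> R powr \<sigma> * (2 powr - \<sigma>) ^ k" .
    have "norm z powr (\<sigma> - DIM('a)) = norm z powr \<sigma> / norm z ^ DIM('a)"
      using z by (simp add: powr_diff powr_realpow)
    also have "\<dots> \<le> R powr \<sigma> * (2 powr - \<sigma>) ^ k / (R / 2 ^ Suc k) ^ DIM('a)"
      using 1 ge z assms by (intro frac_le power_mono) auto
    finally show ?thesis using le True by (intro disjI2 exI[of _ k]) auto
  next
    case False
    then show ?thesis by (auto simp: indicator_def)
  qed
qed (use assms in auto)

lemma nn_integral_norm_powr_infinity:
  fixes \<sigma> \<delta> :: real
  assumes "0 < \<sigma>" "0 < \<delta>"
  shows "(\<integral>\<^sup>+ z. ennreal (indicator (- ball 0 \<delta>) z / norm z powr (DIM('a) + \<sigma>)) \<partial>(lborel :: 'a::euclidean_space measure)) < \<infinity>"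
proof (rule nn_integral_dyadic_balls_finite[where r = "\<lambda>k. \<delta> * 2 ^ k" and M = "1 / \<delta> powr \<sigma>" and q = "2 powr (- \<sigma>)"])
  show "2 powr - \<sigma> < 1" using assms by (simp add: powr_less_one)
  fix z :: 'a
  show "indicator (- ball 0 \<delta>) z / norm z powr (DIM('a) + \<sigma>) \<le> 0 \<or>
    (\<exists>k. norm z \<le> 2 * (\<delta> * 2 ^ k) \<and>
       indicator (- ball 0 \<delta>) z / norm z powr (DIM('a) + \<sigma>) \<le> 1 / \<delta> powr \<sigma> * (2 powr - \<sigma>) ^ k / (\<delta> * 2 ^ k) ^ DIM('a))"
  proof (cases "\<delta> \<le> norm z")
    case True
    then have z: "0 < norm z" using assms by auto
    obtain k where k: "2 ^ k \<le> norm z / \<delta>" "norm z / \<delta> < 2 ^ Suc k"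
      using ex_dyadic_power[of "norm z / \<delta>"] True assms by auto
    have le: "norm z \<le> 2 * (\<delta> * 2 ^ k)" and ge: "\<delta> * 2 ^ k \<le> norm z" using k z assms by (auto simp: field_simps)
    have "(\<delta> * 2 ^ k) powr \<sigma> \<le> norm z powr \<sigma>" using ge assms by (intro powr_mono2) auto
    moreover have "1 / (\<delta> * 2 ^ k) powr \<sigma> = 1 / \<delta> powr \<sigma> * (2 powr - \<sigma>) ^ k"
      using assms
      by (simp add: powr_mult powr_minus_divide powr_realpow[symmetric] powr_powr mult.commute power_one_over)
    ultimately have 1: "1 / norm z powr \<sigma> \<le> 1 / \<delta> powr \<sigma> * (2 powr - \<sigma>) ^ k"
      using assms z by (metis divide_left_mono frac_le less_eq_real_def mult_pos_pos powr_gt_zero zero_less_numeral zero_less_one zero_less_power mult_eq_0_iff order_less_irrefl)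
    have "1 / norm z powr (DIM('a) + \<sigma>) = (1 / norm z powr \<sigma>) / norm z ^ DIM('a)"
      using z by (simp add: powr_add powr_realpow)
    also have "\<dots> \<le> (1 / \<delta> powr \<sigma> * (2 powr - \<sigma>) ^ k) / (\<delta> * 2 ^ k) ^ DIM('a)"
      using 1 ge z assms by (intro frac_le power_mono) auto
    finally show ?thesis using le True by (intro disjI2 exI[of _ k]) auto
  qed (auto simp: indicator_def)
qed (use assms in auto)

section \<open>Smooth functions with compact support\<close>

lemma Cc_infinity_continuous: "f \<in> Cc_infinity \<Omega> \<Longrightarrow> continuous_on UNIV f"
  unfolding Cc_infinity_def mem_Collect_eq by (drule conjunct1, drule spec[of _ 0]) simp

lemma Cc_infinity_borel: "f \<in> Cc_infinity \<Omega> \<Longrightarrow> f \<in> borel_measurable borel"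
  by (intro borel_measurable_continuous_onI Cc_infinity_continuous)

lemma Cc_infinity_support:
  assumes "f \<in> Cc_infinity \<Omega>"
  shows "\<exists>K. compact K \<and> K \<subseteq> \<Omega> \<and> (\<forall>x. x \<notin> K \<longrightarrow> f x = 0)"
proof (intro exI[of _ "closure {x. f x \<noteq> 0}"] conjI allI impI)
  show "compact (closure {x. f x \<noteq> 0})" "closure {x. f x \<noteq> 0} \<subseteq> \<Omega>"
    using assms unfolding Cc_infinity_def by blast+
  fix x assume "x \<notin> closure {x. f x \<noteq> 0}"
  then have "x \<notin> {x. f x \<noteq> 0}" by (meson closure_subset subsetD)
  then show "f x = 0" by simp
qed

lemma continuous_compact_support_bounded:
  fixes f :: "'a::topological_space \<Rightarrow> real"
  assumes "continuous_on UNIV f" "compact K" "\<And>x. x \<notin> K \<Longrightarrow> f x = 0"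
  shows "\<exists>M>0. \<forall>x. \<bar>f x\<bar> \<le> M"
proof -
  have "bounded (f ` K)"
    using assms by (meson compact_continuous_image compact_imp_bounded continuous_on_subset subset_UNIV)
  then obtain M where "M > 0" "\<forall>y\<in>f ` K. norm y \<le> M" using bounded_pos by blast
  then have "\<bar>f x\<bar> \<le> M" for x using assms(3)[of x] by (cases "x \<in> K") auto
  then show ?thesis using \<open>M > 0\<close> by blast
qed

lemma Cc_infinity_bounded:
  assumes f: "f \<in> Cc_infinity \<Omega>"
  shows "\<exists>M>0. \<forall>x. \<bar>f x\<bar> \<le> M"
proof -
  obtain K where K: "compact K" "K \<subseteq> \<Omega>" "\<forall>x. x \<notin> K \<longrightarrow> f x = 0"
    using Cc_infinity_support[OF f] by blast
  show ?thesis by (rule continuous_compact_support_bounded[OF Cc_infinity_continuous[OF f] K(1) K(3)[rule_format]])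
qed

lemma Cc_infinity_lipschitz:
  fixes f :: "'a::euclidean_space \<Rightarrow> real"
  assumes f: "f \<in> Cc_infinity \<Omega>"
  shows "\<exists>L\<ge>0. \<forall>x y. \<bar>f x - f y\<bar> \<le> L * norm (x - y)"
proof -
  obtain K where K: "compact K" "K \<subseteq> \<Omega>" "\<forall>x. x \<notin> K \<longrightarrow> f x = 0"
    using Cc_infinity_support[OF f] by blast
  have "Ck (Suc 0) f" using f by (auto simp: Cc_infinity_def simp del: Ck.simps)
  then have diff: "\<And>x. f differentiable (at x)"
    and cont: "\<And>b. b \<in> Basis \<Longrightarrow> continuous_on UNIV (\<lambda>x. frechet_derivative f (at x) b)"
    by auto
  have zero: "frechet_derivative f (at x) b = 0" if "x \<notin> K" for x b
  proof -
    have "(f has_derivative (\<lambda>_. 0)) (at x)"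
      by (rule has_derivative_transform_within_open[of "\<lambda>_. 0" _ _ _ "- K"])
         (use K that in \<open>auto simp: open_Compl compact_imp_closed\<close>)
    then show ?thesis by (simp add: frechet_derivative_at[symmetric])
  qed
  have "\<forall>b\<in>Basis. \<exists>B. \<forall>x. \<bar>frechet_derivative f (at x) b\<bar> \<le> B"
    using continuous_compact_support_bounded[OF cont K(1) zero] by blast
  then obtain B where "\<forall>b\<in>Basis. \<forall>x. \<bar>frechet_derivative f (at x) b\<bar> \<le> B b"
    by (rule bchoice[THEN exE])
  then have B: "\<And>b x. b \<in> Basis \<Longrightarrow> \<bar>frechet_derivative f (at x) b\<bar> \<le> B b" by simp
  have der: "(f has_derivative frechet_derivative f (at x)) (at x)" for x
    using diff frechet_derivative_works by blast
  have on: "onorm (frechet_derivative f (at x)) \<le> (\<Sum>b\<in>Basis. B b)" for x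
  proof -
    have "onorm (frechet_derivative f (at x)) \<le> (\<Sum>b\<in>Basis. norm (frechet_derivative f (at x) b))"
      by (rule onorm_componentwise[OF has_derivative_bounded_linear[OF der]])
    also have "\<dots> \<le> (\<Sum>b\<in>Basis. B b)" using B by (intro sum_mono) auto
    finally show ?thesis .
  qed
  have "norm (f x - f y) \<le> (\<Sum>b\<in>Basis. B b) * norm (x - y)" for x y
    by (rule differentiable_bound[of UNIV f "\<lambda>x. frechet_derivative f (at x)"])
       (use der on in \<open>auto intro: has_derivative_at_withinI\<close>)
  moreover have "0 \<le> (\<Sum>b\<in>Basis. B b)" by (intro sum_nonneg order_trans[OF abs_ge_zero B])
  ultimately show ?thesis by auto
qed

section \<open>Finiteness of the Gagliardo seminorm\<close>

lemma gagliardo_UNIV: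
  "gagliardo s p UNIV f = (\<integral>\<^sup>+ z. ennreal (\<bar>f (fst z) - f (snd z)\<bar> powr p /
        norm (fst z - snd z :: 'a::euclidean_space) powr (real DIM('a) + s * p)) \<partial>lebesgue)"
  by (simp add: gagliardo_def)

lemma difference_measurable [measurable]:
  "(\<lambda>z. fst z - snd z) \<in> borel_measurable (lebesgue :: ('a::euclidean_space \<times> 'a) measure)"
proof -
  have "(\<lambda>z::'a\<times>'a. fst z - snd z) \<in> borel_measurable lborel"
    using borel_measurable_fst_snd_borel by (intro borel_measurable_diff) auto
  then show ?thesis by (rule measurable_completion)
qed

lemma indicator_fst_snd_measurable:
  assumes "A \<in> sets borel"
  shows "(\<lambda>z :: 'a::euclidean_space \<times> 'a. indicator A (fst z) :: ennreal) \<in> borel_measurable lebesgue"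
    "(\<lambda>z :: 'a::euclidean_space \<times> 'a. indicator A (snd z) :: ennreal) \<in> borel_measurable lebesgue"
proof -
  have "(indicator A :: 'a \<Rightarrow> ennreal) \<in> borel_measurable lebesgue"
    using assms by (intro borel_measurable_indicator) auto
  from measurable_compose[OF measurable_fst_lebesgue this] measurable_compose[OF measurable_snd_lebesgue this]
  show "(\<lambda>z :: 'a::euclidean_space \<times> 'a. indicator A (fst z) :: ennreal) \<in> borel_measurable lebesgue"
    "(\<lambda>z :: 'a::euclidean_space \<times> 'a. indicator A (snd z) :: ennreal) \<in> borel_measurable lebesgue" .
qed

lemma gagliardo_integrand_measurable [measurable]:
  fixes f :: "'a::euclidean_space \<Rightarrow> real"
  assumes [measurable]: "f \<in> borel_measurable lebesgue"
  shows "(\<lambda>z. \<bar>f (fst z) - f (snd z)\<bar> powr p /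
        norm (fst z - snd z :: 'a) powr q) \<in> borel_measurable lebesgue"
proof -
  have [measurable]: "(\<lambda>z::'a\<times>'a. f (fst z)) \<in> borel_measurable lebesgue" "(\<lambda>z::'a\<times>'a. f (snd z)) \<in> borel_measurable lebesgue"
    using measurable_compose[OF measurable_fst_lebesgue assms] measurable_compose[OF measurable_snd_lebesgue assms]
    by auto
  show ?thesis by measurable
qed

text \<open>
  The factor of the first summand tends to 1 as \<open>t \<rightarrow> 0\<close>, which is what an upper bound on the energy of
  approximants needs.
\<close>

lemma gagliardo_add_le:
  fixes f g :: "'a::euclidean_space \<Rightarrow> real"
  assumes [measurable]: "f \<in> borel_measurable lebesgue" "g \<in> borel_measurable lebesgue"
    and p: "1 < p" and t: "0 < t" "t < 1"
  shows "gagliardo s p UNIV (\<lambda>x. f x + g x)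
     \<le> ennreal ((1 - t) powr (1 - p)) * gagliardo s p UNIV f + ennreal (t powr (1 - p)) * gagliardo s p UNIV g"
proof -
  let ?q = "real DIM('a) + s * p"
  let ?F = "\<lambda>f z. ennreal (\<bar>f (fst z) - f (snd z)\<bar> powr p / norm (fst z - snd z :: 'a) powr ?q)"
  have pt: "?F (\<lambda>x. f x + g x) z \<le> ennreal ((1 - t) powr (1 - p)) * ?F f z + ennreal (t powr (1 - p)) * ?F g z"
    for z :: "'a \<times> 'a"
  proof -
    let ?a = "f (fst z) - f (snd z)" and ?b = "g (fst z) - g (snd z)" and ?n = "norm (fst z - snd z) powr ?q"
    have "\<bar>?a + ?b\<bar> powr p \<le> (\<bar>?a\<bar> + \<bar>?b\<bar>) powr p" using p by (intro powr_mono2) auto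
    also have "\<dots> \<le> (1 - t) powr (1 - p) * \<bar>?a\<bar> powr p + t powr (1 - p) * \<bar>?b\<bar> powr p"
      using powr_add_le[OF p t] by simp
    finally have "\<bar>?a + ?b\<bar> powr p / ?n \<le> ((1 - t) powr (1 - p) * \<bar>?a\<bar> powr p + t powr (1 - p) * \<bar>?b\<bar> powr p) / ?n"
      by (intro divide_right_mono) auto
    then have "\<bar>?a + ?b\<bar> powr p / ?n \<le> (1 - t) powr (1 - p) * (\<bar>?a\<bar> powr p / ?n) + t powr (1 - p) * (\<bar>?b\<bar> powr p / ?n)"
      by (simp add: add_divide_distrib)
    then have "ennreal (\<bar>?a + ?b\<bar> powr p / ?n)
       \<le> ennreal ((1 - t) powr (1 - p)) * ennreal (\<bar>?a\<bar> powr p / ?n) + ennreal (t powr (1 - p)) * ennreal (\<bar>?b\<bar> powr p / ?n)"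
      by (simp add: ennreal_mult[symmetric] ennreal_plus[symmetric] ennreal_leI del: ennreal_plus)
    moreover have "?a + ?b = f (fst z) + g (fst z) - (f (snd z) + g (snd z))" by simp
    ultimately show ?thesis by simp
  qed
  have "gagliardo s p UNIV (\<lambda>x. f x + g x) \<le> 
     (\<integral>\<^sup>+ z. ennreal ((1 - t) powr (1 - p)) * ?F f z + ennreal (t powr (1 - p)) * ?F g z \<partial>lebesgue)"
    unfolding gagliardo_UNIV by (intro nn_integral_mono pt)
  also have "\<dots> = ennreal ((1 - t) powr (1 - p)) * gagliardo s p UNIV f + ennreal (t powr (1 - p)) * gagliardo s p UNIV g"
    unfolding gagliardo_UNIV
    by (subst nn_integral_add) (auto simp: nn_integral_cmult)
  finally show ?thesis .
qed

lemma gagliardo_uminus: "gagliardo s p E (\<lambda>x. - f x) = gagliardo s p E f"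
proof -
  have "\<bar>- f x - - f y\<bar> = \<bar>f x - f y\<bar>" for x y by simp
  then show ?thesis by (simp only: gagliardo_def)
qed

lemma gagliardo_finite_add:
  fixes f g :: "'a::euclidean_space \<Rightarrow> real"
  assumes "f \<in> borel_measurable lebesgue" "g \<in> borel_measurable lebesgue" "1 < p"
    "gagliardo s p UNIV f < \<infinity>" "gagliardo s p UNIV g < \<infinity>"
  shows "gagliardo s p UNIV (\<lambda>x. f x + g x) < \<infinity>"
proof -
  have "gagliardo s p UNIV (\<lambda>x. f x + g x) \<le> ennreal ((1 - 1/2) powr (1 - p)) * gagliardo s p UNIV f
     + ennreal ((1/2) powr (1 - p)) * gagliardo s p UNIV g"
    by (rule gagliardo_add_le) (use assms in auto)
  also have "\<dots> < \<infinity>" using assms by (simp add: ennreal_mult_less_top)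
  finally show ?thesis .
qed

lemma nn_integral_kernel_finite:
  fixes g :: "'a::euclidean_space \<Rightarrow> real"
  assumes g: "g \<in> borel_measurable borel" "(\<integral>\<^sup>+ z. ennreal (g z) \<partial>lborel) < \<infinity>"
    and K: "K \<in> sets borel" "bounded K"
  shows "(\<integral>\<^sup>+ z. indicator K (fst z) * ennreal (g (fst z - snd z)) \<partial>lebesgue) < \<infinity>"
    "(\<integral>\<^sup>+ z. indicator K (snd z) * ennreal (g (fst z - snd z)) \<partial>lebesgue) < \<infinity>"
  using nn_integral_difference_kernel[of "\<lambda>x. ennreal (g x)" K] g K emeasure_bounded_finite[of K]
  by (auto simp: nn_integral_completion ennreal_mult_less_top)

text \<open>
  For a bounded function supported in \<open>K\<close>, a pair of points outside \<open>U \<times> U\<close> matters only if one point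
  lies in \<open>K\<close> and the other is at distance at least \<open>\<delta>\<close>. There the kernel is integrable in the second
  point, uniformly over the first, and \<open>K\<close> has finite measure.
\<close>

lemma gagliardo_finite_from_neighbourhood:
  fixes f :: "'a::euclidean_space \<Rightarrow> real"
  assumes p: "1 < p" "0 < s" and f [measurable]: "f \<in> borel_measurable lebesgue"
    and K: "compact K" "\<And>x. x \<notin> K \<Longrightarrow> f x = 0" and M: "\<And>x. \<bar>f x\<bar> \<le> M"
    and U: "0 < \<delta>" "(\<Union>x\<in>K. ball x \<delta>) \<subseteq> U" "open U" and fin: "gagliardo s p U f < \<infinity>"
  shows "gagliardo s p UNIV f < \<infinity>"
proof -
  let ?q = "real DIM('a) + s * p"
  let ?F = "\<lambda>z. ennreal (\<bar>f (fst z) - f (snd z)\<bar> powr p / norm (fst z - snd z :: 'a) powr ?q)"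
  define g where "g = (\<lambda>w::'a. indicator (- ball 0 \<delta>) w / norm w powr ?q)"
  have [measurable]: "- ball (0::'a) \<delta> \<in> sets borel" "K \<in> sets borel" 
    using borel_compact[OF K(1)] by (auto intro: borel_closed)
  have g [measurable]: "g \<in> borel_measurable borel" unfolding g_def by measurable
  have gfin: "(\<integral>\<^sup>+ z. ennreal (g z) \<partial>lborel) < \<infinity>"
    unfolding g_def using nn_integral_norm_powr_infinity[of "s * p" \<delta>] p U by simp
  have [measurable]: "U \<times> U \<in> sets lebesgue"
    using U(3) by (intro sets_completionI_sets) (auto intro!: borel_open open_Times)
  have [measurable]: "(\<lambda>z::'a\<times>'a. indicator K (fst z) :: ennreal) \<in> borel_measurable lebesgue"
     "(\<lambda>z::'a\<times>'a. indicator K (snd z) :: ennreal) \<in> borel_measurable lebesgue"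
    by (rule indicator_fst_snd_measurable, simp)+
  have pt: "?F z \<le> ?F z * indicator (U \<times> U) z + ennreal (M powr p) *
      (indicator K (fst z) * ennreal (g (fst z - snd z)) + indicator K (snd z) * ennreal (g (fst z - snd z)))" for z
  proof (cases "z \<in> U \<times> U")
    case False
    obtain x y where z: "z = (x, y)" by (cases z)
    have "(f x = 0 \<and> f y = 0) \<or> (x \<in> K \<and> f y = 0 \<and> \<delta> \<le> norm (x - y)) \<or> (y \<in> K \<and> f x = 0 \<and> \<delta> \<le> norm (x - y))"
    proof -
      have far: "\<delta> \<le> norm (a - b)" if "a \<in> K" "b \<notin> U" for a b
        using that U(2) by (force simp: dist_norm)
      have sub: "K \<subseteq> U" using U(1,2) by force
      show ?thesis using False K(2) far[of x y] far[of y x] sub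
        by (auto simp: z norm_minus_commute)
    qed
    then show ?thesis
    proof (elim disjE conjE)
      assume "f x = 0" "f y = 0"
      then show ?thesis using p by (simp add: z)
    next
      assume a: "x \<in> K" "f y = 0" "\<delta> \<le> norm (x - y)"
      have "\<bar>f x\<bar> powr p / norm (x - y) powr ?q \<le> M powr p * g (x - y)"
        using a M[of x] p by (auto simp: g_def intro!: divide_right_mono powr_mono2)
      then have "?F z \<le> ennreal (M powr p * g (x - y))" using a(2) by (simp add: z ennreal_leI)
      also have "\<dots> = ennreal (M powr p) * ennreal (g (x - y))" by (rule ennreal_mult') simp
      also have "\<dots> \<le> ennreal (M powr p) * (ennreal (g (x - y)) + indicator K y * ennreal (g (x - y)))"
        by (intro mult_left_mono) auto
      finally show ?thesis using a(1) False by (simp add: z)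
    next
      assume a: "y \<in> K" "f x = 0" "\<delta> \<le> norm (x - y)"
      have "\<bar>f y\<bar> powr p / norm (x - y) powr ?q \<le> M powr p * g (x - y)"
        using a M[of y] p by (auto simp: g_def intro!: divide_right_mono powr_mono2)
      then have "?F z \<le> ennreal (M powr p * g (x - y))" using a(2) by (simp add: z ennreal_leI)
      also have "\<dots> = ennreal (M powr p) * ennreal (g (x - y))" by (rule ennreal_mult') simp
      also have "\<dots> \<le> ennreal (M powr p) * (indicator K x * ennreal (g (x - y)) + ennreal (g (x - y)))"
        by (intro mult_left_mono) auto
      finally show ?thesis using a(1) False by (simp add: z)
    qed
  qed simp
  have gm: "(\<lambda>z::'a\<times>'a. ennreal (g (fst z - snd z))) \<in> borel_measurable lebesgue"
    using measurable_compose[OF difference_measurable g] by simp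
  note [measurable] = gm
  have "gagliardo s p UNIV f \<le> (\<integral>\<^sup>+ z. ?F z * indicator (U \<times> U) z + ennreal (M powr p) *
      (indicator K (fst z) * ennreal (g (fst z - snd z)) + indicator K (snd z) * ennreal (g (fst z - snd z))) \<partial>lebesgue)"
    unfolding gagliardo_UNIV by (intro nn_integral_mono pt)
  also have "\<dots> = gagliardo s p U f + ennreal (M powr p) *
     ((\<integral>\<^sup>+ z. indicator K (fst z) * ennreal (g (fst z - snd z)) \<partial>lebesgue)
    + (\<integral>\<^sup>+ z. indicator K (snd z) * ennreal (g (fst z - snd z)) \<partial>lebesgue))"
    unfolding gagliardo_def
    by (subst nn_integral_add, measurable, subst nn_integral_cmult, measurable, subst nn_integral_add) auto
  also have "\<dots> < \<infinity>"
    using fin nn_integral_kernel_finite[OF g gfin, of K] K(1) 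
    by (simp add: ennreal_mult_less_top compact_imp_bounded)
  finally show ?thesis .
qed

text \<open>
  The Lipschitz bound improves the singularity \<open>|z|\<^sup>-\<^sup>N\<^sup>-\<^sup>s\<^sup>p\<close> of the kernel by a factor \<open>|z|\<^sup>p\<close>, and the
  resulting exponent exceeds \<open>-N\<close> by \<open>p (1 - s) > 0\<close>.
\<close>

lemma gagliardo_lipschitz_bounded_finite:
  fixes f :: "'a::euclidean_space \<Rightarrow> real"
  assumes p: "1 < p" "s < 1" and L: "0 \<le> L" "\<And>x y. \<bar>f x - f y\<bar> \<le> L * norm (x - y)" and R: "0 < R"
  shows "gagliardo s p (ball 0 R) f < \<infinity>"
proof -
  let ?q = "real DIM('a) + s * p" and ?B = "ball (0::'a) R"
  let ?F = "\<lambda>z. ennreal (\<bar>f (fst z) - f (snd z)\<bar> powr p / norm (fst z - snd z :: 'a) powr ?q)"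
  define \<sigma> where "\<sigma> = p * (1 - s)"
  define g where "g = (\<lambda>w::'a. indicator (cball 0 (2 * R)) w * norm w powr (\<sigma> - real DIM('a)))"
  have [measurable]: "cball (0::'a) (2 * R) \<in> sets borel" by (intro borel_closed) auto
  have g [measurable]: "g \<in> borel_measurable borel" unfolding g_def by measurable
  have gfin: "(\<integral>\<^sup>+ z. ennreal (g z) \<partial>lborel) < \<infinity>"
    unfolding g_def using nn_integral_norm_powr_origin[of \<sigma> "2 * R"] p R by (simp add: \<sigma>_def)
  have gm: "(\<lambda>z::'a\<times>'a. ennreal (g (fst z - snd z))) \<in> borel_measurable lebesgue"
    using measurable_compose[OF difference_measurable g] by simp
  have [measurable]: "(\<lambda>z::'a\<times>'a. indicator ?B (fst z) :: ennreal) \<in> borel_measurable lebesgue"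
    by (rule indicator_fst_snd_measurable) simp
  have pt: "?F z * indicator (?B \<times> ?B) z \<le> ennreal (L powr p) * (indicator ?B (fst z) * ennreal (g (fst z - snd z)))" for z
  proof (cases "z \<in> ?B \<times> ?B")
    case True
    obtain x y where z: "z = (x, y)" by (cases z)
    have xy: "x \<in> ?B" "y \<in> ?B" using True z by auto
    have "\<bar>f x - f y\<bar> powr p / norm (x - y) powr ?q \<le> (L * norm (x - y)) powr p / norm (x - y) powr ?q"
      using L(2)[of x y] p by (intro divide_right_mono powr_mono2) auto
    also have "\<dots> = L powr p * (norm (x - y) powr p / norm (x - y) powr ?q)"
      using L by (simp add: powr_mult)
    also have "norm (x - y) powr p / norm (x - y) powr ?q = norm (x - y) powr (\<sigma> - real DIM('a))"
      by (simp add: powr_diff[symmetric] \<sigma>_def algebra_simps)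
    also have "\<dots> = g (x - y)"
      using xy norm_triangle_ineq4[of x y] by (simp add: g_def)
    finally have "?F z \<le> ennreal (L powr p * g (x - y))" by (simp add: z ennreal_leI)
    also have "\<dots> = ennreal (L powr p) * ennreal (g (x - y))" by (rule ennreal_mult') simp
    finally show ?thesis using xy by (simp add: z)
  qed simp
  have "gagliardo s p ?B f \<le> (\<integral>\<^sup>+ z. ennreal (L powr p) * (indicator ?B (fst z) * ennreal (g (fst z - snd z))) \<partial>lebesgue)"
    unfolding gagliardo_def by (intro nn_integral_mono pt)
  also have "\<dots> = ennreal (L powr p) * (\<integral>\<^sup>+ z. indicator ?B (fst z) * ennreal (g (fst z - snd z)) \<partial>lebesgue)"
    using gm by (subst nn_integral_cmult) auto
  also have "\<dots> < \<infinity>" using nn_integral_kernel_finite(1)[OF g gfin, of ?B] by (simp add: ennreal_mult_less_top)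
  finally show ?thesis .
qed

lemma Cc_infinity_gagliardo_finite:
  fixes f :: "'a::euclidean_space \<Rightarrow> real"
  assumes p: "1 < p" "0 < s" "s < 1" and f: "f \<in> Cc_infinity \<Omega>"
  shows "gagliardo s p UNIV f < \<infinity>"
proof -
  obtain K where K: "compact K" "K \<subseteq> \<Omega>" "\<forall>x. x \<notin> K \<longrightarrow> f x = 0"
    using Cc_infinity_support[OF f] by blast
  obtain M where M: "\<And>x. \<bar>f x\<bar> \<le> M" using Cc_infinity_bounded[OF f] by blast
  obtain L where L: "0 \<le> L" "\<And>x y. \<bar>f x - f y\<bar> \<le> L * norm (x - y)" using Cc_infinity_lipschitz[OF f] by blast
  obtain R where R: "0 < R" "\<And>x. x \<in> K \<Longrightarrow> norm x \<le> R"
    using compact_imp_bounded[OF K(1)] bounded_pos by blast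
  have sub: "(\<Union>x\<in>K. ball x 1) \<subseteq> ball 0 (R + 1)"
  proof safe
    fix x y assume "x \<in> K" "y \<in> ball x 1"
    then show "y \<in> ball 0 (R + 1)"
      using R(2)[of x] norm_triangle_ineq2[of y x] by (auto simp: dist_norm norm_minus_commute)
  qed
  show ?thesis
    by (rule gagliardo_finite_from_neighbourhood[OF p(1,2) _ K(1) K(3)[rule_format] M _ sub])
       (use gagliardo_lipschitz_bounded_finite[OF p(1,3) L] R Cc_infinity_borel[OF f] in
         \<open>auto intro: measurable_completion\<close>)
qed

section \<open>Approximation in the energy space\<close>

text \<open>
  Smallness of \<^const>\<open>Wsp_norm\<close> says nothing about an infinite seminorm, which \<^const>\<open>enn2real\<close>
  sends to 0. Both parts of the norm of the difference must therefore first be shown to be finite.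
\<close>

lemma Wsp_tilde0_approx:
  fixes v :: "'a::euclidean_space \<Rightarrow> real"
  assumes p: "1 < p" "0 < s" "s < 1" and v: "v \<in> Wsp_tilde0 s p \<Omega>" and \<eta>: "0 < \<eta>"
  shows "\<exists>\<psi>\<in>Cc_infinity \<Omega>. Lp_int p UNIV (\<lambda>x. v x - \<psi> x) \<le> ennreal \<eta> \<and>
     gagliardo s p UNIV \<psi> \<le> gagliardo s p UNIV v + ennreal \<eta>"
proof -
  have vm [measurable]: "v \<in> borel_measurable lebesgue" and vL: "Lp_int p UNIV v < \<infinity>" and vG: "gagliardo s p UNIV v < \<infinity>"
    using v by (auto simp: Wsp_tilde0_def Wsp_def)
  define G where "G = enn2real (gagliardo s p UNIV v)"
  have G: "gagliardo s p UNIV v = ennreal G" "0 \<le> G" using vG by (auto simp: G_def)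
  have "((\<lambda>t. (1 - t) powr (1 - p) * G) \<longlongrightarrow> (1 - 0) powr (1 - p) * G) (at_right 0)"
    by (intro tendsto_intros) auto
  then have "\<forall>\<^sub>F t in at_right 0. (1 - t) powr (1 - p) * G < G + \<eta> / 2"
    using \<eta> by (intro order_tendstoD) auto
  moreover have "\<forall>\<^sub>F t in at_right 0. t \<in> {0<..<1::real}"
    by (rule eventually_at_right_real) simp
  ultimately have "\<forall>\<^sub>F t in at_right 0. (1 - t) powr (1 - p) * G < G + \<eta> / 2 \<and> t \<in> {0<..<1}"
    by (rule eventually_conj)
  then have "\<exists>t. (1 - t) powr (1 - p) * G < G + \<eta> / 2 \<and> t \<in> {0<..<1}"
    by (rule eventually_happens'[OF trivial_limit_at_right_real])
  then obtain t where t: "(1 - t) powr (1 - p) * G < G + \<eta> / 2" "0 < t" "t < 1" by auto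
  \<comment> \<open>The allowed error \<open>\<eta>\<close> is split evenly: \<open>t\<close> spends one half on the energy of \<open>v\<close>, and \<open>\<kappa>\<close> is small
    enough for the large factor \<open>t\<^sup>1\<^sup>-\<^sup>p\<close> to leave the other half.\<close>
  define \<kappa> where "\<kappa> = min \<eta> (\<eta> / 2 / t powr (1 - p))"
  have \<kappa>: "0 < \<kappa>" using \<eta> t by (simp add: \<kappa>_def)
  have "0 < \<kappa> powr (1 / p)" using \<kappa> by simp
  then obtain \<psi> where \<psi>: "\<psi> \<in> Cc_infinity \<Omega>" "Wsp_norm s p UNIV (\<lambda>x. v x - \<psi> x) < \<kappa> powr (1 / p)"
    using v unfolding Wsp_tilde0_def by blast
  have \<psi>m [measurable]: "\<psi> \<in> borel_measurable lebesgue"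
    using Cc_infinity_borel[OF \<psi>(1)] by (auto intro: measurable_completion)
  let ?w = "\<lambda>x. v x - \<psi> x"
  have Gw: "gagliardo s p UNIV ?w < \<infinity>"
    using gagliardo_finite_add[of v "\<lambda>x. - \<psi> x" p s] vG Cc_infinity_gagliardo_finite[OF p \<psi>(1)] p(1)
    by (simp add: gagliardo_uminus)
  have Lw: "Lp_int p UNIV ?w < \<infinity>"
  proof -
    obtain K where K: "compact K" "K \<subseteq> \<Omega>" "\<forall>x. x \<notin> K \<longrightarrow> \<psi> x = 0"
    using Cc_infinity_support[OF \<psi>(1)] by blast
    obtain M where M: "\<And>x. \<bar>\<psi> x\<bar> \<le> M" using Cc_infinity_bounded[OF \<psi>(1)] by blast
    let ?c = "2 powr (p - 1)"
    have "ennreal (\<bar>?w x\<bar> powr p) \<le> ennreal ?c * ennreal (\<bar>v x\<bar> powr p) + ennreal (?c * M powr p) * indicator K x" for x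
    proof -
      have "\<bar>v x + - \<psi> x\<bar> powr p \<le> ?c * \<bar>v x\<bar> powr p + ?c * \<bar>- \<psi> x\<bar> powr p"
        using powr_abs_add_le[OF p(1)] by blast
      also have "\<dots> \<le> ?c * \<bar>v x\<bar> powr p + ?c * M powr p * indicator K x"
        using K(3)[rule_format, of x] M[of x] p(1) by (auto simp: indicator_def intro!: powr_mono2)
      finally have "ennreal (\<bar>?w x\<bar> powr p) \<le> ennreal (?c * \<bar>v x\<bar> powr p + ?c * M powr p * indicator K x)"
        by (intro ennreal_leI) simp
      then show ?thesis by (simp add: ennreal_mult ennreal_indicator)
    qed
    then have le: "(\<integral>\<^sup>+ x. ennreal (\<bar>?w x\<bar> powr p) \<partial>lebesgue)
       \<le> (\<integral>\<^sup>+ x. ennreal ?c * ennreal (\<bar>v x\<bar> powr p) + ennreal (?c * M powr p) * indicator K x \<partial>lebesgue)"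
      by (intro nn_integral_mono)
    have [measurable]: "K \<in> sets lebesgue" using borel_compact[OF K(1)] by simp
    have "Lp_int p UNIV ?w \<le> (\<integral>\<^sup>+ x. ennreal ?c * ennreal (\<bar>v x\<bar> powr p) + ennreal (?c * M powr p) * indicator K x \<partial>lebesgue)"
      using le by (simp add: Lp_int_def)
    also have "\<dots> = ennreal ?c * Lp_int p UNIV v + ennreal (?c * M powr p) * emeasure lebesgue K"
      unfolding Lp_int_def
      by (subst nn_integral_add) (simp_all add: nn_integral_cmult nn_integral_cmult_indicator)
    also have "\<dots> < \<infinity>"
    proof -
      have "emeasure lebesgue K < \<infinity>"
        using emeasure_bounded_finite[OF compact_imp_bounded[OF K(1)]] borel_compact[OF K(1)] by simp
      then show ?thesis using vL by (simp add: ennreal_mult_less_top)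
    qed
    finally show ?thesis .
  qed
  have small: "X \<le> ennreal \<kappa>" if "X < \<infinity>" "enn2real X powr (1 / p) < \<kappa> powr (1 / p)" for X :: ennreal
  proof -
    have "enn2real X < \<kappa>"
    proof (rule ccontr)
      assume "\<not> enn2real X < \<kappa>"
      then have "\<kappa> powr (1 / p) \<le> enn2real X powr (1 / p)" using \<kappa> p(1) by (intro powr_mono2) auto
      then show False using that(2) by simp
    qed
    then have "ennreal (enn2real X) \<le> ennreal \<kappa>" by (intro ennreal_leI) simp
    then show ?thesis using that(1) by simp
  qed
  have "enn2real (Lp_int p UNIV ?w) powr (1 / p) < \<kappa> powr (1 / p)"
    "enn2real (gagliardo s p UNIV ?w) powr (1 / p) < \<kappa> powr (1 / p)"
    using \<psi>(2) unfolding Wsp_norm_def by (smt (verit) powr_ge_zero)+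
  then have Lk: "Lp_int p UNIV ?w \<le> ennreal \<kappa>" and Gk: "gagliardo s p UNIV ?w \<le> ennreal \<kappa>"
    using small Lw Gw by auto
  have "gagliardo s p UNIV (\<lambda>x. v x + - ?w x) \<le> ennreal ((1 - t) powr (1 - p)) * gagliardo s p UNIV v
     + ennreal (t powr (1 - p)) * gagliardo s p UNIV (\<lambda>x. - ?w x)"
    by (rule gagliardo_add_le) (use p t in auto)
  also have "\<dots> \<le> ennreal ((1 - t) powr (1 - p)) * ennreal G + ennreal (t powr (1 - p)) * ennreal \<kappa>"
    using Gk unfolding G(1) gagliardo_uminus by (intro add_mono mult_left_mono) auto
  also have "\<dots> = ennreal ((1 - t) powr (1 - p) * G + t powr (1 - p) * \<kappa>)"
    using G \<kappa> by (simp add: ennreal_mult)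
  also have "\<dots> \<le> ennreal (G + \<eta>)"
  proof (intro ennreal_leI)
    have "t powr (1 - p) * \<kappa> \<le> t powr (1 - p) * (\<eta> / 2 / t powr (1 - p))" by (intro mult_left_mono) (auto simp: \<kappa>_def)
    also have "\<dots> = \<eta> / 2" using t by simp
    finally show "(1 - t) powr (1 - p) * G + t powr (1 - p) * \<kappa> \<le> G + \<eta>" using t(1) by simp
  qed
  finally have "gagliardo s p UNIV \<psi> \<le> gagliardo s p UNIV v + ennreal \<eta>"
    using G \<eta> by simp
  moreover have "Lp_int p UNIV ?w \<le> ennreal \<eta>" using Lk by (rule order_trans) (auto simp: \<kappa>_def intro!: ennreal_leI)
  ultimately show ?thesis using \<psi>(1) by blast
qed

text \<open>
  Convergence in \<open>L\<^sup>p\<close> gives almost everywhere convergence along a subsequence.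
\<close>

lemma Wsp_tilde0_AE_approx:
  fixes v :: "'a::euclidean_space \<Rightarrow> real"
  assumes p: "1 < p" "0 < s" "s < 1" and v: "v \<in> Wsp_tilde0 s p \<Omega>"
  shows "\<exists>\<psi>::nat \<Rightarrow> 'a \<Rightarrow> real. (\<forall>n. \<psi> n \<in> Cc_infinity \<Omega>) \<and>
     (\<forall>n. gagliardo s p UNIV (\<psi> n) \<le> gagliardo s p UNIV v + ennreal (1 / Suc n)) \<and>
     (AE x in lebesgue. (\<lambda>n. \<psi> n x) \<longlonglongrightarrow> v x)"
proof -
  have vm [measurable]: "v \<in> borel_measurable lebesgue"
    using v unfolding Wsp_tilde0_def Wsp_def lebesgue_on_UNIV_eq by blast
  have "\<forall>n. \<exists>\<psi>. \<psi> \<in> Cc_infinity \<Omega> \<and> Lp_int p UNIV (\<lambda>x. v x - \<psi> x) \<le> ennreal (1 / Suc n) \<and>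
     gagliardo s p UNIV \<psi> \<le> gagliardo s p UNIV v + ennreal (1 / Suc n)"
    using Wsp_tilde0_approx[OF p v, of "1 / Suc n" for n] by auto
  then obtain \<psi> where \<psi>: "\<forall>n. \<psi> n \<in> Cc_infinity \<Omega> \<and> Lp_int p UNIV (\<lambda>x. v x - \<psi> n x) \<le> ennreal (1 / Suc n) \<and>
     gagliardo s p UNIV (\<psi> n) \<le> gagliardo s p UNIV v + ennreal (1 / Suc n)"
    by (rule choice[THEN exE])
  have \<psi>m [measurable]: "\<psi> n \<in> borel_measurable lebesgue" for n
    using Cc_infinity_borel[of "\<psi> n" \<Omega>] \<psi> by (intro measurable_completion) simp
  define f where "f n x = \<bar>v x - \<psi> n x\<bar> powr p" for n x
  have fm [measurable]: "f n \<in> borel_measurable lebesgue" for n unfolding f_def by measurable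
  have fnn: "0 \<le> f n x" for n x by (simp add: f_def)
  have fle: "(\<integral>\<^sup>+ x. ennreal (f n x) \<partial>lebesgue) \<le> ennreal (1 / Suc n)" for n
    using \<psi> unfolding Lp_int_def f_def by simp
  have fint: "integrable lebesgue (f n)" for n
    using fle[of n] by (intro integrableI_nonneg) (auto simp: fnn intro: le_less_trans)
  have fI: "(LINT x|lebesgue. norm (f n x)) \<le> 1 / Suc n" for n
  proof -
    have "ennreal (LINT x|lebesgue. f n x) = (\<integral>\<^sup>+ x. ennreal (f n x) \<partial>lebesgue)"
      by (rule nn_integral_eq_integral[OF fint AE_I2[OF fnn], symmetric])
    then have "ennreal (LINT x|lebesgue. f n x) \<le> ennreal (1 / Suc n)" using fle[of n] by simp
    then have "(LINT x|lebesgue. f n x) \<le> 1 / Suc n" by (subst (asm) ennreal_le_iff) simp_all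
    then show ?thesis using fnn by simp
  qed
  have "(\<lambda>n. LINT x|lebesgue. norm (f n x)) \<longlonglongrightarrow> 0"
  proof (rule tendsto_sandwich[OF _ _ tendsto_const LIMSEQ_Suc[OF lim_1_over_n]])
    show "\<forall>\<^sub>F n in sequentially. 0 \<le> (LINT x|lebesgue. norm (f n x))" by simp
    show "\<forall>\<^sub>F n in sequentially. (LINT x|lebesgue. norm (f n x)) \<le> 1 / real (Suc n)" using fI by simp
  qed
  from tendsto_L1_AE_subseq[OF fint this] obtain r :: "nat \<Rightarrow> nat"
    where r: "strict_mono r" "AE x in lebesgue. (\<lambda>n. f (r n) x) \<longlonglongrightarrow> 0" by blast
  have "AE x in lebesgue. (\<lambda>n. \<psi> (r n) x) \<longlonglongrightarrow> v x"
    using r(2)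
  proof eventually_elim
    case (elim x)
    have "(\<lambda>n. f (r n) x powr (1 / p)) \<longlonglongrightarrow> 0 powr (1 / p)"
      by (rule tendsto_powr'[OF elim tendsto_const]) (use p fnn in auto)
    then have "(\<lambda>n. \<bar>v x - \<psi> (r n) x\<bar>) \<longlonglongrightarrow> 0" using p by (simp add: f_def powr_powr)
    then have "(\<lambda>n. v x - \<psi> (r n) x) \<longlonglongrightarrow> 0" by (rule tendsto_rabs_zero_cancel)
    then have "(\<lambda>n. v x - (v x - \<psi> (r n) x)) \<longlonglongrightarrow> v x - 0" by (intro tendsto_diff tendsto_const)
    then show ?case by simp
  qed
  moreover have "gagliardo s p UNIV (\<psi> (r n)) \<le> gagliardo s p UNIV v + ennreal (1 / Suc n)" for n
  proof -
    have "n \<le> r n" using r(1) by (rule strict_mono_imp_increasing)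
    then have "ennreal (1 / Suc (r n)) \<le> ennreal (1 / Suc n)" by (intro ennreal_leI frac_le) auto
    then show ?thesis using \<psi> by (meson add_left_mono order_trans)
  qed
  ultimately show ?thesis using \<psi> by (intro exI[of _ "\<lambda>n. \<psi> (r n)"]) blast
qed

section \<open>Admissible test functions\<close>

text \<open>
  The tangent of \<open>t\<^sup>p\<close> at the larger of the two points lies below the graph.
\<close>

lemma powr_diff_le_linear:
  fixes p M x y :: real
  assumes "1 < p" "0 \<le> x" "0 \<le> y" "x \<le> M" "y \<le> M"
  shows "\<bar>x powr p - y powr p\<bar> \<le> p * M powr (p - 1) * \<bar>x - y\<bar>"
proof -
  have *: "\<bar>a powr p - b powr p\<bar> \<le> p * M powr (p - 1) * \<bar>a - b\<bar>"
    if ab: "0 \<le> b" "b < a" "a \<le> M" for a b :: real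
  proof -
    have "a powr p + p * a powr (p - 1) * (b - a) < b powr p"
      by (rule powr_above_tangent) (use assms ab in auto)
    then have "a powr p - b powr p \<le> p * a powr (p - 1) * (a - b)" by (simp add: algebra_simps)
    also have "\<dots> \<le> p * M powr (p - 1) * (a - b)"
      using assms ab by (intro mult_right_mono mult_left_mono powr_mono2) auto
    finally have "a powr p - b powr p \<le> p * M powr (p - 1) * (a - b)" .
    moreover have "b powr p \<le> a powr p" using assms ab by (intro powr_mono2) auto
    ultimately show ?thesis using ab by simp
  qed
  consider "x = y" | "y < x" | "x < y" by linarith
  then show ?thesis
  proof cases
    case 3
    then show ?thesis using *[of x y] assms by (simp add: abs_minus_commute)
  qed (use *[of y x] assms in auto)
qed

lemma powr_neg_diff_le_linear:
  fixes p \<epsilon> x y :: real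
  assumes "1 < p" "0 < \<epsilon>" "\<epsilon> \<le> x" "\<epsilon> \<le> y"
  shows "\<bar>1 / x powr (p - 1) - 1 / y powr (p - 1)\<bar> \<le> (p - 1) * \<epsilon> powr (- p) * \<bar>x - y\<bar>"
proof -
  have *: "\<bar>1 / a powr (p - 1) - 1 / b powr (p - 1)\<bar> \<le> (p - 1) * \<epsilon> powr (- p) * \<bar>a - b\<bar>"
    if ab: "\<epsilon> \<le> a" "a < b" for a b :: real
  proof -
    have "\<And>t. a \<le> t \<Longrightarrow> t \<le> b \<Longrightarrow> ((\<lambda>t. t powr (1 - p)) has_real_derivative (1 - p) * t powr (- p)) (at t)"
      using ab assms by (auto intro!: derivative_eq_intros)
    from MVT2[OF ab(2) this] obtain z where z: "a < z" "z < b"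
      "b powr (1 - p) - a powr (1 - p) = (b - a) * ((1 - p) * z powr (- p))" by auto
    have inv: "1 / t powr (p - 1) = t powr (1 - p)" for t :: real
      using powr_minus_divide[of t "p - 1"] by simp
    have "a powr (1 - p) - b powr (1 - p) = (p - 1) * z powr (- p) * (b - a)"
      using z(3) by (simp add: algebra_simps)
    moreover have "0 \<le> (p - 1) * z powr (- p) * (b - a)" using assms ab by simp
    moreover have "(p - 1) * z powr (- p) * (b - a) \<le> (p - 1) * \<epsilon> powr (- p) * (b - a)"
      using assms ab z by (intro mult_right_mono mult_left_mono powr_mono2') auto
    ultimately have "\<bar>a powr (1 - p) - b powr (1 - p)\<bar> \<le> (p - 1) * \<epsilon> powr (- p) * (b - a)"
      by simp
    moreover have "\<bar>a - b\<bar> = b - a" using ab by simp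
    ultimately show ?thesis unfolding inv by simp
  qed
  consider "x = y" | "y < x" | "x < y" by linarith
  then show ?thesis
  proof cases
    case 2
    then show ?thesis using *[of y x] assms by (simp add: abs_minus_commute)
  qed (use *[of x y] assms in auto)
qed

text \<open>
  The quotient is Lipschitz in both variables: the denominator stays above \<open>\<epsilon>\<^sup>p\<^sup>-\<^sup>1\<close> and the numerator
  below \<open>M\<^sup>p\<close>. So the test function inherits fractional regularity from \<open>\<psi>\<close> and \<open>u\<close>, although \<open>u\<close> may be
  unbounded.
\<close>

lemma powr_quotient_lipschitz:
  fixes p M \<epsilon> a b \<alpha> \<beta> :: real
  assumes p: "1 < p" and \<epsilon>: "0 < \<epsilon>" and a: "\<bar>a\<bar> \<le> M" and b: "\<bar>b\<bar> \<le> M" and "0 \<le> \<alpha>" "0 \<le> \<beta>"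
  shows "\<bar>\<bar>a\<bar> powr p / (\<alpha> + \<epsilon>) powr (p - 1) - \<bar>b\<bar> powr p / (\<beta> + \<epsilon>) powr (p - 1)\<bar>
     \<le> p * M powr (p - 1) / \<epsilon> powr (p - 1) * \<bar>a - b\<bar> + M powr p * ((p - 1) * \<epsilon> powr (- p)) * \<bar>\<alpha> - \<beta>\<bar>"
proof -
  let ?A = "1 / (\<alpha> + \<epsilon>) powr (p - 1)" and ?B = "1 / (\<beta> + \<epsilon>) powr (p - 1)"
  have "\<bar>(\<bar>a\<bar> powr p - \<bar>b\<bar> powr p) * ?A\<bar> \<le> (p * M powr (p - 1) * \<bar>a - b\<bar>) * (1 / \<epsilon> powr (p - 1))"
  proof -
    have "\<bar>\<bar>a\<bar> powr p - \<bar>b\<bar> powr p\<bar> \<le> p * M powr (p - 1) * \<bar>\<bar>a\<bar> - \<bar>b\<bar>\<bar>"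
      using p a b by (intro powr_diff_le_linear) auto
    also have "\<dots> \<le> p * M powr (p - 1) * \<bar>a - b\<bar>" using p by (intro mult_left_mono) auto
    finally have 1: "\<bar>\<bar>a\<bar> powr p - \<bar>b\<bar> powr p\<bar> \<le> p * M powr (p - 1) * \<bar>a - b\<bar>" .
    have "\<epsilon> powr (p - 1) \<le> (\<alpha> + \<epsilon>) powr (p - 1)" using assms by (intro powr_mono2) auto
    then have 2: "?A \<le> 1 / \<epsilon> powr (p - 1)" using \<epsilon> by (intro frac_le) auto
    show ?thesis unfolding abs_mult using 1 2 p by (intro mult_mono) auto
  qed
  moreover have "\<bar>\<bar>b\<bar> powr p * (?A - ?B)\<bar> \<le> M powr p * ((p - 1) * \<epsilon> powr (- p) * \<bar>\<alpha> - \<beta>\<bar>)"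
  proof -
    have "\<bar>?A - ?B\<bar> \<le> (p - 1) * \<epsilon> powr (- p) * \<bar>\<alpha> - \<beta>\<bar>"
      using powr_neg_diff_le_linear[of p \<epsilon> "\<alpha> + \<epsilon>" "\<beta> + \<epsilon>"] assms by simp
    moreover have "\<bar>b\<bar> powr p \<le> M powr p" using p b by (intro powr_mono2) auto
    ultimately show ?thesis unfolding abs_mult by (intro mult_mono) auto
  qed
  moreover have "\<bar>a\<bar> powr p / (\<alpha> + \<epsilon>) powr (p - 1) - \<bar>b\<bar> powr p / (\<beta> + \<epsilon>) powr (p - 1)
     = (\<bar>a\<bar> powr p - \<bar>b\<bar> powr p) * ?A + \<bar>b\<bar> powr p * (?A - ?B)"
    by (simp add: algebra_simps diff_divide_distrib)
  ultimately show ?thesis by (simp only:) (rule order_trans[OF abs_triangle_ineq], simp add: mult_ac)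
qed

lemma gagliardo_le_of_differences:
  fixes f g h :: "'a::euclidean_space \<Rightarrow> real"
  assumes meas [measurable]: "g \<in> borel_measurable lebesgue" "h \<in> borel_measurable lebesgue"
    and p: "1 < p" and AB: "0 \<le> A" "0 \<le> B" and U: "open U"
    and le: "\<And>x y. \<bar>f x - f y\<bar> \<le> A * \<bar>g x - g y\<bar> + B * \<bar>h x - h y\<bar>"
    and fin: "gagliardo s p U g < \<infinity>" "gagliardo s p U h < \<infinity>"
  shows "gagliardo s p U f < \<infinity>"
proof -
  let ?q = "real DIM('a) + s * p"
  let ?F = "\<lambda>f z. ennreal (\<bar>f (fst z) - f (snd z)\<bar> powr p / norm (fst z - snd z :: 'a) powr ?q)"
  let ?a = "2 powr (p - 1) * A powr p" and ?b = "2 powr (p - 1) * B powr p"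
  have [measurable]: "U \<times> U \<in> sets lebesgue"
    using borel_open[OF open_Times[OF U U]] by (intro sets_completionI_sets) simp
  have pt: "?F f z \<le> ennreal ?a * ?F g z + ennreal ?b * ?F h z" for z
  proof -
    let ?n = "norm (fst z - snd z) powr ?q"
    let ?g = "\<bar>g (fst z) - g (snd z)\<bar>" and ?h = "\<bar>h (fst z) - h (snd z)\<bar>"
    have "\<bar>f (fst z) - f (snd z)\<bar> powr p \<le> (A * ?g + B * ?h) powr p"
      using le p by (intro powr_mono2) auto
    also have "\<dots> = \<bar>A * ?g + B * ?h\<bar> powr p" using AB by simp
    also have "\<dots> \<le> 2 powr (p - 1) * \<bar>A * ?g\<bar> powr p + 2 powr (p - 1) * \<bar>B * ?h\<bar> powr p"
      by (rule powr_abs_add_le[OF p])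
    also have "\<dots> = ?a * ?g powr p + ?b * ?h powr p"
      using AB by (simp add: powr_mult)
    finally have "\<bar>f (fst z) - f (snd z)\<bar> powr p / ?n \<le> (?a * ?g powr p + ?b * ?h powr p) / ?n"
      by (intro divide_right_mono) auto
    also have "\<dots> = ?a * (?g powr p / ?n) + ?b * (?h powr p / ?n)" by (simp add: add_divide_distrib)
    finally have "?F f z \<le> ennreal (?a * (?g powr p / ?n) + ?b * (?h powr p / ?n))"
      by (rule ennreal_leI)
    also have "\<dots> = ennreal (?a * (?g powr p / ?n)) + ennreal (?b * (?h powr p / ?n))"
      by (rule ennreal_plus) auto
    also have "\<dots> = ennreal ?a * ennreal (?g powr p / ?n) + ennreal ?b * ennreal (?h powr p / ?n)"
      by (simp only: ennreal_mult' ennreal_mult'' zero_le_divide_iff powr_ge_zero zero_le_mult_iff simp_thms)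
    finally show ?thesis .
  qed
  have "gagliardo s p U f \<le> (\<integral>\<^sup>+ z. ennreal ?a * (?F g z * indicator (U \<times> U) z) + ennreal ?b * (?F h z * indicator (U \<times> U) z) \<partial>lebesgue)"
    unfolding gagliardo_def
  proof (intro nn_integral_mono)
    fix z :: "'a \<times> 'a"
    show "?F f z * indicator (U \<times> U) z \<le> ennreal ?a * (?F g z * indicator (U \<times> U) z) + ennreal ?b * (?F h z * indicator (U \<times> U) z)"
      using pt[of z] by (cases "z \<in> U \<times> U") simp_all
  qed
  also have "\<dots> = ennreal ?a * gagliardo s p U g + ennreal ?b * gagliardo s p U h"
    unfolding gagliardo_def by (subst nn_integral_add) (simp_all add: nn_integral_cmult)
  also have "\<dots> < \<infinity>" using fin by (simp add: ennreal_mult_less_top)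
  finally show ?thesis .
qed

lemma gagliardo_mono: 
  assumes "E \<subseteq> F" shows "gagliardo s p E f \<le> gagliardo s p F f"
  unfolding gagliardo_def using assms
  by (intro nn_integral_mono mult_left_mono) (auto simp: indicator_def)

text \<open>
  The function \<open>u\<close> has fractional regularity only in compactly contained open sets, so the Lipschitz bound
  is used near the support of \<open>\<psi>\<close>, and boundedness elsewhere. The absolute value of \<open>u\<close> keeps the
  denominator away from zero at every point, and not only almost everywhere.
\<close>

lemma quotient_test_function_Wsp:
  fixes u :: "'a::euclidean_space \<Rightarrow> real"
  assumes p: "1 < p" "0 < s" "s < 1" and \<Omega>: "open \<Omega>"
    and u: "u \<in> Wsp_loc s p \<Omega>" and um [measurable]: "u \<in> borel_measurable lebesgue"
    and \<psi>: "\<psi> \<in> Cc_infinity \<Omega>" and \<epsilon>: "0 < \<epsilon>"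
  shows "(\<lambda>x. \<bar>\<psi> x\<bar> powr p / (\<bar>u x\<bar> + \<epsilon>) powr (p - 1)) \<in> Wsp s p UNIV"
proof -
  let ?\<phi> = "\<lambda>x. \<bar>\<psi> x\<bar> powr p / (\<bar>u x\<bar> + \<epsilon>) powr (p - 1)"
  have \<psi>m [measurable]: "\<psi> \<in> borel_measurable lebesgue"
    using Cc_infinity_borel[OF \<psi>] by (intro measurable_completion) simp
  obtain K where K: "compact K" "K \<subseteq> \<Omega>" "\<forall>x. x \<notin> K \<longrightarrow> \<psi> x = 0"
    using Cc_infinity_support[OF \<psi>] by blast
  obtain M where M: "0 < M" "\<forall>x. \<bar>\<psi> x\<bar> \<le> M" using Cc_infinity_bounded[OF \<psi>] by blast
  obtain \<delta> where \<delta>: "0 < \<delta>" "(\<Union>x\<in>K. cball x \<delta>) \<subseteq> \<Omega>"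
    by (rule compact_subset_open_imp_cball_epsilon_subset[OF K(1) \<Omega> K(2)])
  define U where "U = (\<Union>x\<in>K. ball x \<delta>)"
  have U: "open U" unfolding U_def by (intro open_UN ballI open_ball)
  have eq: "(\<Union>x\<in>K. cball x \<delta>) = {x + y | x y. x \<in> K \<and> y \<in> cball 0 \<delta>}"
  proof (intro set_eqI iffI)
    fix w assume "w \<in> (\<Union>x\<in>K. cball x \<delta>)"
    then obtain x where "x \<in> K" "dist x w \<le> \<delta>" by auto
    then show "w \<in> {x + y | x y. x \<in> K \<and> y \<in> cball 0 \<delta>}"
      by (intro CollectI exI[of _ x] exI[of _ "w - x"]) (simp add: dist_norm norm_minus_commute)
  next
    fix w assume "w \<in> {x + y | x y. x \<in> K \<and> y \<in> cball 0 \<delta>}"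
    then obtain x y where "w = x + y" "x \<in> K" "norm y \<le> \<delta>" by auto
    then show "w \<in> (\<Union>x\<in>K. cball x \<delta>)" by (intro UN_I[of x]) (simp_all add: dist_norm)
  qed
  have cpt: "compact (\<Union>x\<in>K. cball x \<delta>)"
    unfolding eq by (rule compact_sums[OF K(1) compact_cball])
  have "U \<subseteq> (\<Union>x\<in>K. cball x \<delta>)" unfolding U_def by (intro UN_mono ball_subset_cball) auto
  then have clU: "closure U \<subseteq> (\<Union>x\<in>K. cball x \<delta>)"
    using cpt by (intro closure_minimal compact_imp_closed)
  have "compact (closure U)"
    unfolding compact_closure
    by (rule bounded_subset[OF compact_imp_bounded[OF cpt] order_trans[OF closure_subset clU]])
  moreover have "closure U \<subseteq> \<Omega>" using clU \<delta>(2) by (rule order_trans)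
  ultimately have uU: "gagliardo s p U u < \<infinity>" using u U unfolding Wsp_loc_def Wsp_def by blast
  have \<psi>U: "gagliardo s p U \<psi> < \<infinity>"
    using gagliardo_mono[of U UNIV s p \<psi>] Cc_infinity_gagliardo_finite[OF p \<psi>] by (simp add: order_le_less_trans)
  let ?A = "p * M powr (p - 1) / \<epsilon> powr (p - 1)" and ?B = "M powr p * ((p - 1) * \<epsilon> powr (- p))"
  have AB: "0 \<le> ?A" "0 \<le> ?B" using p by simp_all
  have "\<bar>?\<phi> x - ?\<phi> y\<bar> \<le> ?A * \<bar>\<psi> x - \<psi> y\<bar> + ?B * \<bar>u x - u y\<bar>" for x y
  proof -
    have "\<bar>?\<phi> x - ?\<phi> y\<bar> \<le> ?A * \<bar>\<psi> x - \<psi> y\<bar> + ?B * \<bar>\<bar>u x\<bar> - \<bar>u y\<bar>\<bar>"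
      by (rule powr_quotient_lipschitz[OF p(1) \<epsilon>]) (use M in auto)
    also have "\<dots> \<le> ?A * \<bar>\<psi> x - \<psi> y\<bar> + ?B * \<bar>u x - u y\<bar>"
      by (intro add_left_mono mult_left_mono AB abs_triangle_ineq3)
    finally show ?thesis .
  qed
  then have \<phi>U: "gagliardo s p U ?\<phi> < \<infinity>"
    by (rule gagliardo_le_of_differences[OF \<psi>m um p(1) AB U _ \<psi>U uU])
  have bd: "\<bar>?\<phi> x\<bar> \<le> M powr p / \<epsilon> powr (p - 1)" for x
  proof -
    have "\<bar>\<psi> x\<bar> powr p / (\<bar>u x\<bar> + \<epsilon>) powr (p - 1) \<le> M powr p / \<epsilon> powr (p - 1)"
      using M p \<epsilon> by (intro frac_le powr_mono2) auto
    then show ?thesis by simp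
  qed
  have \<phi>K: "?\<phi> x = 0" if "x \<notin> K" for x using K(3) that by simp
  have \<phi>m [measurable]: "?\<phi> \<in> borel_measurable lebesgue" by measurable
  have "gagliardo s p UNIV ?\<phi> < \<infinity>"
    by (rule gagliardo_finite_from_neighbourhood[OF p(1,2) \<phi>m K(1) \<phi>K bd \<delta>(1) _ U \<phi>U])
       (simp_all add: U_def)
  moreover have "Lp_int p UNIV ?\<phi> < \<infinity>"
  proof -
    let ?c = "M powr p / \<epsilon> powr (p - 1)"
    have [measurable]: "K \<in> sets lebesgue" using borel_compact[OF K(1)] by simp
    have "Lp_int p UNIV ?\<phi> \<le> (\<integral>\<^sup>+ x. ennreal (?c powr p) * indicator K x \<partial>lebesgue)"
      unfolding Lp_int_def
    proof (intro nn_integral_mono)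
      fix x
      show "ennreal (\<bar>?\<phi> x\<bar> powr p) * indicator UNIV x \<le> ennreal (?c powr p) * indicator K x"
      proof (cases "x \<in> K")
        case True
        then show ?thesis using bd[of x] p by (simp add: ennreal_leI powr_mono2)
      next
        case False
        then show ?thesis using \<phi>K[of x] by simp
      qed
    qed
    also have "\<dots> = ennreal (?c powr p) * emeasure lebesgue K" by (rule nn_integral_cmult_indicator) simp
    also have "\<dots> < \<infinity>"
      using emeasure_bounded_finite[OF compact_imp_bounded[OF K(1)]] borel_compact[OF K(1)]
      by (simp add: ennreal_mult_less_top)
    finally show ?thesis .
  qed
  ultimately show ?thesis using \<phi>m by (simp add: Wsp_def lebesgue_on_UNIV_eq)
qed

section \<open>The reciprocal of the boundary distance\<close>

lemma bdist_pos:
  assumes "open \<Omega>" "frontier \<Omega> \<noteq> {}" "x \<in> \<Omega>"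
  shows "0 < bdist \<Omega> x"
proof -
  have "x \<notin> frontier \<Omega>" using assms(1,3) frontier_disjoint_eq[of \<Omega>] by blast
  then show ?thesis unfolding bdist_def by (intro infdist_pos_not_in_closed assms(2) frontier_closed)
qed

lemma bdist_borel: "bdist \<Omega> \<in> borel_measurable borel"
  unfolding bdist_def by (intro borel_measurable_continuous_onI continuous_intros)


text \<open>
  The function \<open>g\<close> measures height in the direction \<open>e\<close>. Translation along \<open>e\<close> shows that halving the
  height of a layer above \<open>g = 0\<close> halves its measure. Hence each layer \<open>b/2\<^sup>n\<^sup>+\<^sup>1 < g \<le> b/2\<^sup>n\<close> contributes at
  least the same positive amount \<open>c\<close> to the integral. Apart from positivity on open sets, only
  translation invariance of the measure enters, so the isometry in the local description of the boundary
  needs no change of variables.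
\<close>

lemma nn_integral_reciprocal_height_infinite:
  fixes A :: "'a::euclidean_space set" and g :: "'a \<Rightarrow> real" and e :: 'a and f :: "'a \<Rightarrow> ennreal"
  assumes A: "open A" and g: "continuous_on A g"
    and shift: "\<And>x c. x + c *\<^sub>R e \<in> A \<longleftrightarrow> x \<in> A" "\<And>x c. x \<in> A \<Longrightarrow> g (x + c *\<^sub>R e) = g x + c"
    and ne: "A \<noteq> {}" and b: "0 < b" and f [measurable]: "f \<in> borel_measurable lborel"
    and le: "\<And>x. x \<in> A \<Longrightarrow> 0 < g x \<Longrightarrow> g x \<le> b \<Longrightarrow> ennreal (1 / g x) \<le> f x"
  shows "(\<integral>\<^sup>+ x. f x \<partial>lborel) = \<infinity>"
proof -
  define S where "S \<alpha> \<beta> = {x \<in> A. \<alpha> < g x \<and> g x \<le> \<beta>}" for \<alpha> \<beta>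
  have Sm [measurable]: "S \<alpha> \<beta> \<in> sets borel" for \<alpha> \<beta>
  proof -
    have "open {x \<in> A. \<alpha> < g x}" "open {x \<in> A. \<beta> < g x}"
      using continuous_open_preimage[OF g A, of "{\<alpha><..}"] continuous_open_preimage[OF g A, of "{\<beta><..}"]
      by (simp_all add: Int_def vimage_def)
    then have "{x \<in> A. \<alpha> < g x} - {x \<in> A. \<beta> < g x} \<in> sets borel" by (intro sets.Diff borel_open)
    moreover have "S \<alpha> \<beta> = {x \<in> A. \<alpha> < g x} - {x \<in> A. \<beta> < g x}" by (auto simp: S_def)
    ultimately show ?thesis by simp
  qed
  let ?m = "\<lambda>\<alpha> \<beta>. emeasure lborel (S \<alpha> \<beta>)"
  have trans: "?m (\<alpha> + c) (\<beta> + c) = ?m \<alpha> \<beta>" for \<alpha> \<beta> c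
  proof -
    have "(\<lambda>x. c *\<^sub>R e + x) -` S (\<alpha> + c) (\<beta> + c) = S \<alpha> \<beta>"
      using shift by (auto simp: S_def add.commute[of "c *\<^sub>R e"])
    moreover have "?m (\<alpha> + c) (\<beta> + c) = emeasure (distr lborel borel ((+) (c *\<^sub>R e))) (S (\<alpha> + c) (\<beta> + c))"
      by (simp add: lborel_distr_plus)
    ultimately show ?thesis by (subst (asm) emeasure_distr) simp_all
  qed
  define r where "r n = b / 2 ^ n" for n
  have r: "0 < r n" "r (Suc n) = r n / 2" for n using b by (simp_all add: r_def)
  have bottom: "?m 0 (r (Suc n)) = ?m (r (Suc n)) (r n)" for n
  proof -
    have "r (Suc n) + r (Suc n) = r n" using r(2)[of n] by simp
    then show ?thesis using trans[of 0 "r (Suc n)" "r (Suc n)"] by simp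
  qed
  have half: "?m 0 (r n) = ?m (r (Suc n)) (r n) + ?m (r (Suc n)) (r n)" for n
  proof -
    have "S 0 (r n) = S 0 (r (Suc n)) \<union> S (r (Suc n)) (r n)" "S 0 (r (Suc n)) \<inter> S (r (Suc n)) (r n) = {}"
      using r[of n] by (auto simp: S_def)
    then have "?m 0 (r n) = ?m 0 (r (Suc n)) + ?m (r (Suc n)) (r n)" by (simp add: plus_emeasure)
    then show ?thesis using bottom[of n] by simp
  qed
  have layer: "2 ^ Suc n * ?m (r (Suc n)) (r n) = ?m 0 b" for n
  proof (induction n)
    case 0
    show ?case using half[of 0] by (simp add: r_def mult_2)
  next
    case (Suc n)
    have "?m (r (Suc n)) (r n) = 2 * ?m (r (Suc (Suc n))) (r (Suc n))"
      using half[of "Suc n"] bottom[of n] by (simp add: mult_2)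
    then show ?case using Suc by (simp add: mult_ac)
  qed
  have pos: "0 < ?m 0 b"
  proof -
    obtain x where x: "x \<in> A" using ne by blast
    define y where "y = x + (b / 2 - g x) *\<^sub>R e"
    have y: "y \<in> A" "g y = b / 2" using shift x by (simp_all add: y_def)
    have op: "open {x \<in> A. g x \<in> {0<..<b}}"
      using continuous_open_preimage[OF g A, of "{0<..<b}"] by (simp add: Int_def vimage_def)
    have "y \<in> {x \<in> A. g x \<in> {0<..<b}}" using y b by simp
    then have "\<not> negligible {x \<in> A. g x \<in> {0<..<b}}" using open_not_negligible[OF op] by blast
    then have "{x \<in> A. g x \<in> {0<..<b}} \<notin> null_sets lborel"
      using null_sets_completionI negligible_iff_null_sets by blast
    then have "0 < emeasure lborel {x \<in> A. g x \<in> {0<..<b}}"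
      using borel_open[OF op] by (simp add: null_sets_def zero_less_iff_neq_zero)
    also have "\<dots> \<le> ?m 0 b" using Sm[of 0 b] by (intro emeasure_mono) (auto simp: S_def)
    finally show ?thesis .
  qed
  define c where "c = ennreal (1 / (2 * b)) * ?m 0 b"
  have c: "0 < c" using pos b by (simp add: c_def ennreal_zero_less_mult_iff)
  have step: "c \<le> (\<integral>\<^sup>+ x. f x * indicator (S (r (Suc n)) (r n)) x \<partial>lborel)" for n
  proof -
    have "c = ennreal (1 / (2 * b)) * (2 ^ Suc n * ?m (r (Suc n)) (r n))" unfolding layer c_def ..
    also have "\<dots> = ennreal (1 / r n) * ?m (r (Suc n)) (r n)"
    proof -
      have "ennreal (1 / (2 * b)) * 2 ^ Suc n = ennreal (1 / (2 * b)) * ennreal (2 ^ Suc n)"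
        by (subst ennreal_power[symmetric]) (simp_all del: power_Suc)
      also have "\<dots> = ennreal (1 / r n)" using b by (simp add: ennreal_mult[symmetric] r_def)
      finally show ?thesis by (simp add: mult.assoc[symmetric])
    qed
    also have "\<dots> = (\<integral>\<^sup>+ x. ennreal (1 / r n) * indicator (S (r (Suc n)) (r n)) x \<partial>lborel)"
      by (simp add: nn_integral_cmult_indicator)
    also have "\<dots> \<le> (\<integral>\<^sup>+ x. f x * indicator (S (r (Suc n)) (r n)) x \<partial>lborel)"
    proof (intro nn_integral_mono)
      fix x
      show "ennreal (1 / r n) * indicator (S (r (Suc n)) (r n)) x \<le> f x * indicator (S (r (Suc n)) (r n)) x"
      proof (cases "x \<in> S (r (Suc n)) (r n)")
        case True
        then have x: "x \<in> A" "0 < g x" "g x \<le> r n" using r(1)[of "Suc n"] by (auto simp: S_def)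
        have "r n \<le> b" using b by (simp add: r_def divide_le_eq)
        then have "ennreal (1 / g x) \<le> f x" using x by (intro le) auto
        moreover have "ennreal (1 / r n) \<le> ennreal (1 / g x)" using x by (intro ennreal_leI frac_le) auto
        ultimately show ?thesis using True by simp
      qed simp
    qed
    finally show ?thesis .
  qed
  have "of_nat n * c \<le> (\<integral>\<^sup>+ x. f x * indicator (S (r n) b) x \<partial>lborel)" for n
  proof (induction n)
    case (Suc n)
    have "r (Suc n) < r n" using r(1)[of n] r(2)[of n] by linarith
    moreover have "r n \<le> b" using b by (simp add: r_def divide_le_eq)
    ultimately have rn: "r (Suc n) < r n" "r n \<le> b" by simp_all
    have ind: "indicator (S (r (Suc n)) b) x = (indicator (S (r n) b) x + indicator (S (r (Suc n)) (r n)) x :: ennreal)" for x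
      using rn by (auto simp: S_def indicator_def)
    have "of_nat (Suc n) * c = of_nat n * c + c" by (simp add: distrib_right add.commute)
    also have "\<dots> \<le> (\<integral>\<^sup>+ x. f x * indicator (S (r n) b) x \<partial>lborel)
        + (\<integral>\<^sup>+ x. f x * indicator (S (r (Suc n)) (r n)) x \<partial>lborel)"
      by (intro add_mono Suc step)
    also have "\<dots> = (\<integral>\<^sup>+ x. f x * indicator (S (r (Suc n)) b) x \<partial>lborel)"
      unfolding ind distrib_left by (rule nn_integral_add[symmetric]) measurable
    finally show ?case .
  qed simp
  moreover have "(\<integral>\<^sup>+ x. f x * indicator (S (r n) b) x \<partial>lborel) \<le> (\<integral>\<^sup>+ x. f x \<partial>lborel)" for n
    by (intro nn_integral_mono) (simp add: indicator_def)
  ultimately have all: "of_nat n * c \<le> (\<integral>\<^sup>+ x. f x \<partial>lborel)" for n by (meson order_trans)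
  show ?thesis
  proof (rule ccontr)
    assume "(\<integral>\<^sup>+ x. f x \<partial>lborel) \<noteq> \<infinity>"
    then obtain I where I: "(\<integral>\<^sup>+ x. f x \<partial>lborel) = ennreal I" "0 \<le> I" 
      by (cases "\<integral>\<^sup>+ x. f x \<partial>lborel") auto
    have "c \<le> ennreal I" using all[of 1] I by simp
    then obtain c' where c': "c = ennreal c'" "0 \<le> c'" by (cases c) (auto simp: top_unique)
    have "0 < c'" using c c' by simp
    then obtain n where "I < of_nat n * c'" using reals_Archimedean3[of c'] by blast
    moreover have "of_nat n * c' \<le> I"
      using all[of n] I c' by (simp add: ennreal_of_nat_eq_real_of_nat ennreal_mult[symmetric])
    ultimately show False by simp
  qed
qed

text \<open>
  In the chart, the height of a point above the graph is the distance to the point of the graph below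
  it, and this bounds the distance to the boundary.
\<close>

lemma nn_integral_reciprocal_bdist_infinite:
  fixes \<Omega> :: "'a::euclidean_space set"
  assumes \<Omega>: "open \<Omega>" and x0: "x\<^sub>0 \<in> frontier \<Omega>" and loc: "locally_continuous_boundary_at \<Omega> x\<^sub>0"
  shows "(\<integral>\<^sup>+ x. ennreal (1 / bdist \<Omega> x) * indicator \<Omega> x \<partial>lborel) = \<infinity>"
proof -
  obtain e :: 'a and \<delta>0 \<delta>1 O' \<Psi> where e: "e \<in> Basis" and \<delta>: "0 < \<delta>0" "0 < \<delta>1"
    and iso: "\<forall>x y. dist (O' x) (O' y) = dist x y" and O0: "O' x\<^sub>0 = 0"
    and \<Psi>: "continuous_on (base_cube e \<delta>0) \<Psi>" "\<Psi> ` base_cube e \<delta>0 \<subseteq> {-\<delta>1<..<\<delta>1}"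
    and In: "cylinder e \<delta>0 \<delta>1 \<inter> O' ` \<Omega> =
          {x \<in> cylinder e \<delta>0 \<delta>1. \<Psi> (x - (x \<bullet> e) *\<^sub>R e) < x \<bullet> e \<and> x \<bullet> e < \<delta>1}"
    and Fr: "cylinder e \<delta>0 \<delta>1 \<inter> O' ` frontier \<Omega> =
          {x \<in> cylinder e \<delta>0 \<delta>1. x \<bullet> e = \<Psi> (x - (x \<bullet> e) *\<^sub>R e)}"
    using loc unfolding locally_continuous_boundary_at_def by (elim bexE exE conjE) (rule that)
  have ee: "e \<bullet> e = 1" using e by simp
  have injO: "O' x = O' y \<Longrightarrow> x = y" for x y using iso by (metis dist_eq_0_iff)
  define T where "T x = O' (x + x\<^sub>0)" for x
  have T: "orthogonal_transformation T"
    unfolding orthogonal_transformation_isometry using iso O0 by (simp add: T_def)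
  then have linT: "linear T" by (rule orthogonal_transformation_linear)
  obtain e' where e': "T e' = e" using orthogonal_transformation_surj[OF T] by (metis surjD)
  have norme': "norm e' = 1" using orthogonal_transformation_norm[OF T, of e'] e e' by simp
  have OT: "O' x = T (x - x\<^sub>0)" for x by (simp add: T_def)
  have shiftO: "O' (x + c *\<^sub>R e') = O' x + c *\<^sub>R e" for x c
  proof -
    have "x + c *\<^sub>R e' - x\<^sub>0 = (x - x\<^sub>0) + c *\<^sub>R e'" by simp
    then show ?thesis unfolding OT by (simp only: linear_add[OF linT] linear_cmul[OF linT] e')
  qed
  have contO: "continuous_on UNIV O'"
    unfolding OT[abs_def] by (intro linear_continuous_on_compose[OF _ linT] continuous_intros)
  define h where "h x = O' x - (O' x \<bullet> e) *\<^sub>R e" for x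
  have conth: "continuous_on UNIV h" unfolding h_def by (intro continuous_intros contO)
  have he: "h x \<bullet> e = 0" for x by (simp add: h_def inner_diff_left ee)
  have hshift: "h (x + c *\<^sub>R e') = h x" for x c
    by (simp add: h_def shiftO inner_add_left ee algebra_simps)
  have \<Psi>0: "\<Psi> 0 = 0" and 0: "(0::'a) \<in> base_cube e \<delta>0"
  proof -
    show 0: "(0::'a) \<in> base_cube e \<delta>0" using \<delta> by (simp add: base_cube_def)
    then have "0 \<in> cylinder e \<delta>0 \<delta>1" using \<delta> by (simp add: cylinder_def)
    moreover have "0 \<in> O' ` frontier \<Omega>" using x0 O0 by (metis image_eqI)
    ultimately have "0 \<in> {x \<in> cylinder e \<delta>0 \<delta>1. x \<bullet> e = \<Psi> (x - (x \<bullet> e) *\<^sub>R e)}" using Fr by blast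
    then show "\<Psi> 0 = 0" by simp
  qed
  \<comment> \<open>With \<open>|\<Psi>| < b\<close> near the origin, points of height at most \<open>b\<close> above the graph stay inside the
    cylinder.\<close>
  define b where "b = \<delta>1 / 2"
  have b: "0 < b" using \<delta> by (simp add: b_def)
  obtain r where r: "0 < r" "\<And>z. z \<in> base_cube e \<delta>0 \<Longrightarrow> norm z < r \<Longrightarrow> \<bar>\<Psi> z\<bar> < b"
  proof -
    obtain r where "0 < r" "\<forall>z\<in>base_cube e \<delta>0. dist z 0 < r \<longrightarrow> dist (\<Psi> z) (\<Psi> 0) < b"
      using \<Psi>(1) 0 b unfolding continuous_on_iff by blast
    then show thesis using \<Psi>0 by (intro that[of r]) simp_all
  qed
  define A where "A = {x. h x \<in> base_cube e \<delta>0 \<and> norm (h x) < r}"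
  define g where "g x = O' x \<bullet> e - \<Psi> (h x)" for x
  have A: "open A"
  proof -
    have "A = (\<Inter>i\<in>Basis - {e}. {x. \<bar>h x \<bullet> i\<bar> < \<delta>0}) \<inter> {x. norm (h x) < r}"
      by (auto simp: A_def base_cube_def he)
    moreover have "open {x. \<bar>h x \<bullet> i\<bar> < \<delta>0}" for i
      by (intro open_Collect_less continuous_intros conth)
    moreover have "open {x. norm (h x) < r}"
      by (intro open_Collect_less continuous_intros conth)
    ultimately show ?thesis by (simp add: open_INT open_Int)
  qed
  have g: "continuous_on A g"
  proof -
    have "continuous_on A (\<lambda>x. \<Psi> (h x))"
      by (rule continuous_on_compose2[OF \<Psi>(1) continuous_on_subset[OF conth]]) (auto simp: A_def)
    then show ?thesis unfolding g_def by (intro continuous_intros continuous_on_subset[OF contO]) auto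
  qed
  have key: "x \<in> \<Omega> \<and> 0 < bdist \<Omega> x \<and> bdist \<Omega> x \<le> g x" if x: "x \<in> A" and gx: "0 < g x" "g x \<le> b" for x
  proof -
    have hx: "h x \<in> base_cube e \<delta>0" "\<bar>\<Psi> (h x)\<bar> < b" using x r by (auto simp: A_def)
    have "\<bar>O' x \<bullet> e\<bar> < \<delta>1" using hx gx by (auto simp: g_def b_def)
    then have "O' x \<in> {x \<in> cylinder e \<delta>0 \<delta>1. \<Psi> (x - (x \<bullet> e) *\<^sub>R e) < x \<bullet> e \<and> x \<bullet> e < \<delta>1}"
      using hx gx by (simp add: cylinder_def h_def[symmetric] g_def)
    then have "O' x \<in> O' ` \<Omega>" using In by blast
    then have x\<Omega>: "x \<in> \<Omega>" using injO by blast
    \<comment> \<open>The point of the graph vertically below \<open>x\<close>.\<close>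
    define y where "y = x + (- g x) *\<^sub>R e'"
    have hy: "h y = h x" unfolding y_def by (rule hshift)
    have Oy: "O' y \<bullet> e = \<Psi> (h y)"
      unfolding y_def shiftO hshift by (simp add: inner_add_left ee g_def)
    have "O' y \<in> {x \<in> cylinder e \<delta>0 \<delta>1. x \<bullet> e = \<Psi> (x - (x \<bullet> e) *\<^sub>R e)}"
    proof -
      have "O' y - (O' y \<bullet> e) *\<^sub>R e = h y" by (simp add: h_def)
      moreover have "\<bar>O' y \<bullet> e\<bar> < \<delta>1" using hx(2) Oy hy \<delta> by (simp add: b_def)
      ultimately show ?thesis using hx(1) hy Oy unfolding cylinder_def by simp
    qed
    then have "O' y \<in> O' ` frontier \<Omega>" using Fr by blast
    then have y: "y \<in> frontier \<Omega>" using injO by blast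
    have "bdist \<Omega> x \<le> dist x y" unfolding bdist_def by (rule infdist_le[OF y])
    also have "\<dots> = g x" using gx norme' by (simp add: y_def dist_norm)
    finally have "bdist \<Omega> x \<le> g x" .
    moreover have "0 < bdist \<Omega> x"
      using y by (intro bdist_pos[OF \<Omega> _ x\<Omega>]) blast
    ultimately show ?thesis using x\<Omega> by blast
  qed
  have [measurable]: "bdist \<Omega> \<in> borel_measurable lborel" using bdist_borel by simp
  have [measurable]: "\<Omega> \<in> sets borel" using \<Omega> by simp
  show ?thesis
  proof (rule nn_integral_reciprocal_height_infinite[OF A g _ _ _ b])
    show "x + c *\<^sub>R e' \<in> A \<longleftrightarrow> x \<in> A" for x c by (simp add: A_def hshift)
    show "g (x + c *\<^sub>R e') = g x + c" for x c
      by (simp add: g_def hshift shiftO inner_add_left ee)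
    have "x\<^sub>0 \<in> A" using 0 O0 r(1) by (simp add: A_def h_def)
    then show "A \<noteq> {}" by blast
    show "(\<lambda>x. ennreal (1 / bdist \<Omega> x) * indicator \<Omega> x) \<in> borel_measurable lborel" by measurable
    show "ennreal (1 / g x) \<le> ennreal (1 / bdist \<Omega> x) * indicator \<Omega> x"
      if "x \<in> A" "0 < g x" "g x \<le> b" for x
      using key[OF that] that by (simp add: ennreal_leI frac_le)
  qed
qed

section \<open>Testing the supersolution\<close>

text \<open>
  The distance to the boundary is bounded below on the support of \<open>\<psi>\<close>. The factor \<open>h\<close> leaves room for
  the weight that comes from regularising the supersolution.
\<close>

lemma Cc_infinity_hardy_integrable:
  fixes h :: "'a::euclidean_space \<Rightarrow> real"
  assumes p: "1 < p" and \<Omega>: "open \<Omega>" "frontier \<Omega> \<noteq> {}"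
    and \<psi>: "\<psi> \<in> Cc_infinity \<Omega>" and hm [measurable]: "h \<in> borel_measurable lebesgue" and h: "\<And>x. 0 \<le> h x" "\<And>x. h x \<le> 1"
  shows "integrable lebesgue (\<lambda>x. indicator \<Omega> x * (h x * (\<bar>\<psi> x\<bar> powr p / bdist \<Omega> x powr q)))"
proof -
  obtain K where K: "compact K" "K \<subseteq> \<Omega>" "\<forall>x. x \<notin> K \<longrightarrow> \<psi> x = 0"
    using Cc_infinity_support[OF \<psi>] by blast
  obtain M where M: "0 < M" "\<forall>x. \<bar>\<psi> x\<bar> \<le> M" using Cc_infinity_bounded[OF \<psi>] by blast
  have \<psi>m [measurable]: "\<psi> \<in> borel_measurable lebesgue"
    using Cc_infinity_borel[OF \<psi>] by (intro measurable_completion) simp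
  have dc: "continuous_on UNIV (bdist \<Omega>)" unfolding bdist_def by (intro continuous_intros)
  have dm [measurable]: "bdist \<Omega> \<in> borel_measurable lebesgue"
    using bdist_borel by (intro measurable_completion) simp
  have [measurable]: "K \<in> sets lebesgue" "\<Omega> \<in> sets lebesgue" using borel_compact[OF K(1)] \<Omega>(1) by simp_all
  have pos: "0 < bdist \<Omega> x" if "x \<in> \<Omega>" for x
    by (rule bdist_pos[OF \<Omega> that])
  have "continuous_on K (\<lambda>x. 1 / bdist \<Omega> x powr q)"
  proof (intro continuous_intros continuous_on_subset[OF dc] ballI)
    fix x assume "x \<in> K"
    then have "0 < bdist \<Omega> x" using pos K(2) by blast
    then show "bdist \<Omega> x \<noteq> 0" "bdist \<Omega> x powr q \<noteq> 0" by simp_all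
  qed simp
  then have "bounded ((\<lambda>x. 1 / bdist \<Omega> x powr q) ` K)"
    using K(1) by (intro compact_imp_bounded compact_continuous_image)
  then obtain D where D: "0 < D" "\<forall>y\<in>(\<lambda>x. 1 / bdist \<Omega> x powr q) ` K. norm y \<le> D" 
    unfolding bounded_pos by blast
  have bound: "norm (indicator \<Omega> x * (h x * (\<bar>\<psi> x\<bar> powr p / bdist \<Omega> x powr q))) \<le> norm (M powr p * D * indicator K x)" for x
  proof (cases "x \<in> K")
    case True
    have "h x * (\<bar>\<psi> x\<bar> powr p * (1 / bdist \<Omega> x powr q)) \<le> 1 * (M powr p * D)"
      using D True M p h[of x] by (intro mult_mono powr_mono2) auto
    then show ?thesis using True K(2) D(1) h[of x] by (simp add: subset_iff)
  next
    case False
    then show ?thesis using K(3) by simp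
  qed
  have fin: "emeasure lebesgue K < \<infinity>"
    using emeasure_bounded_finite[OF compact_imp_bounded[OF K(1)]] borel_compact[OF K(1)] by simp
  have int: "integrable lebesgue (\<lambda>x. M powr p * D * indicator K x)"
    using fin by (intro integrable_mult_right integrable_real_indicator) auto
  show ?thesis
    by (rule Bochner_Integration.integrable_bound[OF int _ AE_I2[OF bound]]) measurable
qed

lemma open_set_AE_False:
  fixes S :: "'a::euclidean_space set"
  assumes "open S" "AE x in lebesgue. x \<notin> S"
  shows "S = {}"
proof -
  have "S \<in> null_sets lebesgue" using assms by (subst AE_iff_null_sets) auto
  then have "negligible S" by (simp add: negligible_iff_null_sets)
  then show ?thesis using assms(1) open_not_negligible by blast
qed

text \<open>
  Testing with \<open>|\<psi>|\<^sup>p / (|u| + \<epsilon>)\<^sup>p\<^sup>-\<^sup>1\<close> and subtracting from the energy density of \<open>\<psi>\<close> leaves the Picone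
  defect, because adding \<open>\<epsilon>\<close> does not change differences of \<open>u\<close>. Integrability of the left side of the
  weak inequality comes for free: the right side is strictly positive, while the integral of a
  non-integrable function is 0 by convention.
\<close>

lemma supersolution_picone_inequality:
  fixes u :: "'a::euclidean_space \<Rightarrow> real"
  assumes p: "1 < p" "0 < s" "s < 1" and \<Omega>: "open \<Omega>" "frontier \<Omega> \<noteq> {}"
    and sup: "local_weak_supersolution s p lam \<Omega> u" and pos: "positive_on \<Omega> u" and lam: "0 < lam"
    and \<psi>: "\<psi> \<in> Cc_infinity \<Omega>" and \<epsilon>: "0 < \<epsilon>"
  shows "(\<integral>\<^sup>+ z. ennreal (picone p (\<psi> (fst z)) (\<psi> (snd z)) (\<bar>u (fst z)\<bar> + \<epsilon>) (\<bar>u (snd z)\<bar> + \<epsilon>) /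
            norm (fst z - snd z) powr (real DIM('a) + s * p)) \<partial>lebesgue)
    + ennreal lam * (\<integral>\<^sup>+ x. ennreal (indicator \<Omega> x * ((\<bar>u x\<bar> / (\<bar>u x\<bar> + \<epsilon>)) powr (p - 1) *
          (\<bar>\<psi> x\<bar> powr p / bdist \<Omega> x powr (s * p)))) \<partial>lebesgue)
    \<le> gagliardo s p UNIV \<psi>"
    (is "(\<integral>\<^sup>+ z. ennreal (?P z) \<partial>lebesgue) + ennreal lam * (\<integral>\<^sup>+ x. ennreal (?H x) \<partial>lebesgue) \<le> _")
proof (cases "\<exists>x. \<psi> x \<noteq> 0")
  case False
  then show ?thesis by (simp add: picone_def)
next
  case True
  let ?q = "real DIM('a) + s * p"
  let ?n = "\<lambda>z::'a\<times>'a. norm (fst z - snd z) powr ?q"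
  let ?\<phi> = "\<lambda>x. \<bar>\<psi> x\<bar> powr p / (\<bar>u x\<bar> + \<epsilon>) powr (p - 1)"
  let ?G = "\<lambda>z. \<bar>\<psi> (fst z) - \<psi> (snd z)\<bar> powr p / ?n z"
  let ?K = "\<lambda>z. J p (u (fst z) - u (snd z)) * (?\<phi> (fst z) - ?\<phi> (snd z)) / ?n z"
  have uloc: "u \<in> Wsp_loc s p \<Omega>" and tail: "u \<in> Lsp_tail s p"
    using sup unfolding local_weak_supersolution_def by blast+
  have um [measurable]: "u \<in> borel_measurable lebesgue"
    using tail unfolding Lsp_tail_def Lp_loc_def lebesgue_on_UNIV_eq by blast
  have \<psi>m [measurable]: "\<psi> \<in> borel_measurable lebesgue"
    using Cc_infinity_borel[OF \<psi>] by (intro measurable_completion) simp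
  have unn: "AE x in lebesgue. 0 \<le> u x" and upos: "AE x in lebesgue. x \<in> \<Omega> \<longrightarrow> 0 < u x"
    using pos unfolding positive_on_def by blast+
  obtain S where S: "compact S" "S \<subseteq> \<Omega>" "\<forall>x. x \<notin> S \<longrightarrow> \<psi> x = 0"
    using Cc_infinity_support[OF \<psi>] by blast

  have \<phi>1: "?\<phi> \<in> Wsp s p UNIV" by (rule quotient_test_function_Wsp[OF p \<Omega>(1) uloc um \<psi> \<epsilon>])
  have \<phi>2: "AE x in lebesgue. 0 \<le> ?\<phi> x" by simp
  have \<phi>3: "\<exists>K. compact K \<and> K \<subseteq> \<Omega> \<and> (AE x in lebesgue. x \<notin> K \<longrightarrow> ?\<phi> x = 0)"
    using S by (intro exI[of _ S]) simp
  have weak: "lam * (LINT x:\<Omega>|lebesgue. \<bar>u x\<bar> powr (p - 2) * u x / bdist \<Omega> x powr (s * p) * ?\<phi> x)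
     \<le> (LINT z|lebesgue. ?K z)"
    by (rule sup[unfolded local_weak_supersolution_def, THEN conjunct2, THEN conjunct2, THEN bspec,
          THEN mp, OF \<phi>1 conjI[OF \<phi>2 \<phi>3]])

  have Hint: "integrable lebesgue ?H"
    by (rule Cc_infinity_hardy_integrable[OF p(1) \<Omega> \<psi>]) (use p \<epsilon> in \<open>auto intro!: powr_le1\<close>)
  have Hnn: "0 \<le> ?H x" for x by simp
  have "(LINT x:\<Omega>|lebesgue. \<bar>u x\<bar> powr (p - 2) * u x / bdist \<Omega> x powr (s * p) * ?\<phi> x) = (LINT x|lebesgue. ?H x)"
    unfolding set_lebesgue_integral_def
  proof (rule integral_cong_AE)
    show "?H \<in> borel_measurable lebesgue" using Hint by simp
    have [measurable]: "bdist \<Omega> \<in> borel_measurable lebesgue"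
      using bdist_borel by (intro measurable_completion) simp
    have [measurable]: "\<Omega> \<in> sets lebesgue" using \<Omega>(1) by simp
    show "(\<lambda>x. indicat_real \<Omega> x *\<^sub>R (\<bar>u x\<bar> powr (p - 2) * u x / bdist \<Omega> x powr (s * p) * ?\<phi> x)) \<in> borel_measurable lebesgue"
      by measurable
    show "AE x in lebesgue. indicat_real \<Omega> x *\<^sub>R (\<bar>u x\<bar> powr (p - 2) * u x / bdist \<Omega> x powr (s * p) * ?\<phi> x) = ?H x"
      using upos
    proof eventually_elim
      case (elim x)
      show ?case
      proof (cases "x \<in> \<Omega>")
        case True
        then have ux: "0 < u x" using elim by simp
        have "\<bar>u x\<bar> powr (p - 2) * u x = u x powr (p - 1)" using ux J_nonneg_arg[of "u x" p] by (simp add: J_def)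
        then show ?thesis using True ux \<epsilon> by (simp add: powr_divide)
      qed simp
    qed
  qed
  with weak have weak': "lam * (LINT x|lebesgue. ?H x) \<le> (LINT z|lebesgue. ?K z)" by simp

  \<comment> \<open>The open set where \<open>\<psi> \<noteq> 0\<close> is nonempty, lies in \<open>\<Omega>\<close>, and carries a positive integrand.\<close>
  have Hpos: "0 < (LINT x|lebesgue. ?H x)"
  proof (rule ccontr)
    assume "\<not> 0 < (LINT x|lebesgue. ?H x)"
    moreover have "0 \<le> (LINT x|lebesgue. ?H x)" by (intro Bochner_Integration.integral_nonneg Hnn)
    ultimately have "(LINT x|lebesgue. ?H x) = 0" by linarith
    then have "AE x in lebesgue. ?H x = 0"
      using integral_nonneg_eq_0_iff_AE[OF Hint AE_I2[OF Hnn]] by simp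
    then have "AE x in lebesgue. x \<notin> {x. \<psi> x \<noteq> 0}"
      using upos
    proof eventually_elim
      case (elim x)
      show ?case
      proof
        assume "x \<in> {x. \<psi> x \<noteq> 0}"
        then have ne: "\<psi> x \<noteq> 0" and x: "x \<in> \<Omega>" using S by auto
        have "0 < u x" using elim x by simp
        moreover have "0 < bdist \<Omega> x"
          by (rule bdist_pos[OF \<Omega> x])
        ultimately have "0 < ?H x" using ne x \<epsilon> by simp
        then show False using elim(1) by linarith
      qed
    qed
    moreover have "open {x. \<psi> x \<noteq> 0}"
      by (intro open_Collect_neq Cc_infinity_continuous[OF \<psi>] continuous_on_const)
    ultimately have "{x. \<psi> x \<noteq> 0} = {}" by (intro open_set_AE_False)
    then show False using True by blast
  qed
  \<comment> \<open>A non-integrable \<open>K\<close> would have integral 0, below the positive lower bound.\<close>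
  have Kint: "integrable lebesgue ?K"
  proof (rule ccontr)
    assume "\<not> integrable lebesgue ?K"
    then have "(LINT z|lebesgue. ?K z) = 0" by (rule not_integrable_integral_eq)
    moreover have "0 < lam * (LINT x|lebesgue. ?H x)" using lam Hpos by simp
    ultimately show False using weak' by simp
  qed
  have Gm: "?G \<in> borel_measurable lebesgue" by (rule gagliardo_integrand_measurable[OF \<psi>m])
  have Gnn: "0 \<le> ?G z" for z by simp
  have Gfin: "(\<integral>\<^sup>+ z. ennreal (?G z) \<partial>lebesgue) < \<infinity>"
    using Cc_infinity_gagliardo_finite[OF p \<psi>] unfolding gagliardo_UNIV .
  have Gint: "integrable lebesgue ?G"
    using Gm Gfin by (intro integrableI_nonneg) auto
  have Geq: "gagliardo s p UNIV \<psi> = ennreal (LINT z|lebesgue. ?G z)"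
    unfolding gagliardo_UNIV by (rule nn_integral_eq_integral[OF Gint AE_I2[OF Gnn]])
  have PGK: "AE z in lebesgue. ?P z = ?G z - ?K z"
    using AE_lebesgue_fst[OF unn] AE_lebesgue_snd[OF unn]
  proof eventually_elim
    case (elim z)
    have "\<bar>u (fst z)\<bar> + \<epsilon> - (\<bar>u (snd z)\<bar> + \<epsilon>) = u (fst z) - u (snd z)" using elim by simp
    then show ?case unfolding picone_def by (simp add: diff_divide_distrib)
  qed
  have Pnn: "0 \<le> ?P z" for z
    by (intro divide_nonneg_nonneg picone_nonneg p(1)) (use \<epsilon> in auto)
  have GKnn: "AE z in lebesgue. 0 \<le> ?G z - ?K z"
    using PGK
  proof eventually_elim
    case (elim z)
    then show ?case using Pnn[of z] by linarith
  qed
  have "(\<integral>\<^sup>+ z. ennreal (?P z) \<partial>lebesgue) = (\<integral>\<^sup>+ z. ennreal (?G z - ?K z) \<partial>lebesgue)"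
    by (intro nn_integral_cong_AE eventually_mono[OF PGK]) simp
  also have "\<dots> = ennreal (LINT z|lebesgue. ?G z - ?K z)"
    by (rule nn_integral_eq_integral[OF Bochner_Integration.integrable_diff[OF Gint Kint] GKnn])
  also have "(LINT z|lebesgue. ?G z - ?K z) = (LINT z|lebesgue. ?G z) - (LINT z|lebesgue. ?K z)"
    by (rule Bochner_Integration.integral_diff[OF Gint Kint])
  finally have Pint: "(\<integral>\<^sup>+ z. ennreal (?P z) \<partial>lebesgue) = ennreal ((LINT z|lebesgue. ?G z) - (LINT z|lebesgue. ?K z))" .
  have GK: "0 \<le> (LINT z|lebesgue. ?G z) - (LINT z|lebesgue. ?K z)"
    using integral_nonneg_AE[OF GKnn] Bochner_Integration.integral_diff[OF Gint Kint] by simp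
  have Hnint: "(\<integral>\<^sup>+ x. ennreal (?H x) \<partial>lebesgue) = ennreal (LINT x|lebesgue. ?H x)"
    by (rule nn_integral_eq_integral[OF Hint AE_I2[OF Hnn]])
  have "ennreal ((LINT z|lebesgue. ?G z) - (LINT z|lebesgue. ?K z)) + ennreal lam * ennreal (LINT x|lebesgue. ?H x)
     = ennreal ((LINT z|lebesgue. ?G z) - (LINT z|lebesgue. ?K z) + lam * (LINT x|lebesgue. ?H x))"
    using GK lam Hpos by (simp only: ennreal_mult' ennreal_plus less_imp_le mult_nonneg_nonneg)
  also have "\<dots> \<le> ennreal (LINT z|lebesgue. ?G z)"
    using weak' by (intro ennreal_leI) linarith
  finally show ?thesis unfolding Pint Hnint Geq .
qed

section \<open>Non-attainment\<close>

text \<open>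
  Fatou turns the inequalities for the approximants into one for \<open>v\<close>, in which the two sides can only be
  equal. The Hardy terms are at least
  1 in the limit, so they alone already use up the energy \<open>\<lambda>\<close> of \<open>v\<close>.
\<close>

lemma minimiser_proportional_to_supersolution:
  fixes u v :: "'a::euclidean_space \<Rightarrow> real"
  assumes p: "1 < p" "0 < s" "s < 1" and \<Omega>: "open \<Omega>" "frontier \<Omega> \<noteq> {}"
    and sup: "local_weak_supersolution s p lam \<Omega> u" and pos: "positive_on \<Omega> u" and lam: "0 < lam"
    and v: "v \<in> Wsp_tilde0 s p \<Omega>" "hardy_int s p \<Omega> v = 1" "gagliardo s p UNIV v = ennreal lam"
  shows "AE z in lebesgue. z \<in> \<Omega> \<times> \<Omega> \<longrightarrow> \<bar>v (fst z)\<bar> * u (snd z) = \<bar>v (snd z)\<bar> * u (fst z)"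
proof -
  let ?q = "real DIM('a) + s * p"
  let ?n = "\<lambda>z::'a\<times>'a. norm (fst z - snd z) powr ?q"
  obtain \<psi> where \<psi>: "\<forall>n. \<psi> n \<in> Cc_infinity \<Omega>"
     "\<forall>n. gagliardo s p UNIV (\<psi> n) \<le> gagliardo s p UNIV v + ennreal (1 / Suc n)"
     "AE x in lebesgue. (\<lambda>n. \<psi> n x) \<longlonglongrightarrow> v x"
    using Wsp_tilde0_AE_approx[OF p v(1)] by blast
  define \<epsilon> where "\<epsilon> n = 1 / real (Suc n)" for n
  have \<epsilon>: "0 < \<epsilon> n" for n by (simp add: \<epsilon>_def)
  have \<epsilon>0: "\<epsilon> \<longlonglongrightarrow> 0" unfolding \<epsilon>_def by (rule LIMSEQ_Suc[OF lim_1_over_n])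
  have tail: "u \<in> Lsp_tail s p"
    using sup unfolding local_weak_supersolution_def by blast
  have um [measurable]: "u \<in> borel_measurable lebesgue"
    using tail unfolding Lsp_tail_def Lp_loc_def lebesgue_on_UNIV_eq by blast
  have vm [measurable]: "v \<in> borel_measurable lebesgue"
    using v(1) unfolding Wsp_tilde0_def Wsp_def lebesgue_on_UNIV_eq by blast
  have \<psi>m [measurable]: "\<psi> n \<in> borel_measurable lebesgue" for n
    using Cc_infinity_borel[of "\<psi> n" \<Omega>] \<psi> by (intro measurable_completion) simp
  have dm [measurable]: "bdist \<Omega> \<in> borel_measurable lebesgue"
    using bdist_borel by (intro measurable_completion) simp
  have \<Omega>m [measurable]: "\<Omega> \<in> sets lebesgue" using \<Omega> by simp
  have \<Omega>2m [measurable]: "\<Omega> \<times> \<Omega> \<in> sets lebesgue"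
    using borel_open[OF open_Times[OF \<Omega>(1) \<Omega>(1)]] by (intro sets_completionI_sets) simp
  have upos: "AE x in lebesgue. x \<in> \<Omega> \<longrightarrow> 0 < u x"
    using pos unfolding positive_on_def by blast
  have fs [measurable]: "(\<lambda>z::'a\<times>'a. g (fst z)) \<in> borel_measurable lebesgue" 
    "(\<lambda>z::'a\<times>'a. g (snd z)) \<in> borel_measurable lebesgue"
    if "g \<in> borel_measurable lebesgue" for g :: "'a \<Rightarrow> real"
    using measurable_compose[OF measurable_fst_lebesgue that] measurable_compose[OF measurable_snd_lebesgue that]
    by auto
  define P where "P n z = picone p (\<psi> n (fst z)) (\<psi> n (snd z)) (\<bar>u (fst z)\<bar> + \<epsilon> n) (\<bar>u (snd z)\<bar> + \<epsilon> n) / ?n z" for n z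
  define H where "H n x = indicator \<Omega> x * ((\<bar>u x\<bar> / (\<bar>u x\<bar> + \<epsilon> n)) powr (p - 1) *
          (\<bar>\<psi> n x\<bar> powr p / bdist \<Omega> x powr (s * p)))" for n x
  define Pv where "Pv z = picone p (v (fst z)) (v (snd z)) \<bar>u (fst z)\<bar> \<bar>u (snd z)\<bar> / ?n z" for z
  define Hv where "Hv x = \<bar>v x\<bar> powr p / bdist \<Omega> x powr (s * p)" for x
  have Pm [measurable]: "P n \<in> borel_measurable lebesgue" for n
  proof -
    have [measurable]: "(\<lambda>z. \<psi> n (fst z)) \<in> borel_measurable lebesgue" "(\<lambda>z. \<psi> n (snd z)) \<in> borel_measurable lebesgue"
      "(\<lambda>z. u (fst z)) \<in> borel_measurable lebesgue" "(\<lambda>z. u (snd z)) \<in> borel_measurable lebesgue"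
      using fs[OF \<psi>m[of n]] fs[OF um] by simp_all
    show ?thesis unfolding P_def picone_def J_def by measurable
  qed
  have Pvm [measurable]: "Pv \<in> borel_measurable lebesgue"
  proof -
    have [measurable]: "(\<lambda>z. v (fst z)) \<in> borel_measurable lebesgue" "(\<lambda>z. v (snd z)) \<in> borel_measurable lebesgue"
      "(\<lambda>z. u (fst z)) \<in> borel_measurable lebesgue" "(\<lambda>z. u (snd z)) \<in> borel_measurable lebesgue"
      using fs[OF vm] fs[OF um] by simp_all
    show ?thesis unfolding Pv_def picone_def J_def by measurable
  qed
  have Hm [measurable]: "H n \<in> borel_measurable lebesgue" for n unfolding H_def by measurable
  have Plim: "AE z in lebesgue. z \<in> \<Omega> \<times> \<Omega> \<longrightarrow> (\<lambda>n. P n z) \<longlonglongrightarrow> Pv z"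
    using AE_lebesgue_fst[OF upos] AE_lebesgue_snd[OF upos] AE_lebesgue_fst[OF \<psi>(3)] AE_lebesgue_snd[OF \<psi>(3)]
  proof eventually_elim
    case (elim z)
    show ?case
    proof
      assume z: "z \<in> \<Omega> \<times> \<Omega>"
      have ux: "0 < u (fst z)" "0 < u (snd z)" using elim(1,2) z by (auto simp: mem_Times_iff)
      have quot: "(\<lambda>n. \<bar>\<psi> n x\<bar> powr p / (\<bar>u x\<bar> + \<epsilon> n) powr (p - 1)) \<longlonglongrightarrow> \<bar>v x\<bar> powr p / \<bar>u x\<bar> powr (p - 1)"
        if "(\<lambda>n. \<psi> n x) \<longlonglongrightarrow> v x" "0 < u x" for x
      proof (rule tendsto_divide)
        show "(\<lambda>n. \<bar>\<psi> n x\<bar> powr p) \<longlonglongrightarrow> \<bar>v x\<bar> powr p"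
          by (rule tendsto_powr'[OF tendsto_rabs[OF that(1)] tendsto_const]) (use p in auto)
        have "(\<lambda>n. \<bar>u x\<bar> + \<epsilon> n) \<longlonglongrightarrow> \<bar>u x\<bar> + 0" by (intro tendsto_add tendsto_const \<epsilon>0)
        then show "(\<lambda>n. (\<bar>u x\<bar> + \<epsilon> n) powr (p - 1)) \<longlonglongrightarrow> \<bar>u x\<bar> powr (p - 1)"
          using that(2) by (intro tendsto_powr tendsto_const) auto
        show "\<bar>u x\<bar> powr (p - 1) \<noteq> 0" using that(2) by simp
      qed
      have d: "(\<lambda>n. \<bar>\<psi> n (fst z) - \<psi> n (snd z)\<bar> powr p) \<longlonglongrightarrow> \<bar>v (fst z) - v (snd z)\<bar> powr p"
        by (rule tendsto_powr'[OF tendsto_rabs[OF tendsto_diff[OF elim(3,4)]] tendsto_const]) (use p in auto)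
      have "(\<lambda>n. picone p (\<psi> n (fst z)) (\<psi> n (snd z)) (\<bar>u (fst z)\<bar> + \<epsilon> n) (\<bar>u (snd z)\<bar> + \<epsilon> n))
         \<longlonglongrightarrow> picone p (v (fst z)) (v (snd z)) \<bar>u (fst z)\<bar> \<bar>u (snd z)\<bar>"
        unfolding picone_def add_diff_cancel_right
        by (intro tendsto_diff d tendsto_mult tendsto_const quot elim ux)
      then have "(\<lambda>n. picone p (\<psi> n (fst z)) (\<psi> n (snd z)) (\<bar>u (fst z)\<bar> + \<epsilon> n) (\<bar>u (snd z)\<bar> + \<epsilon> n) * (1 / ?n z))
         \<longlonglongrightarrow> picone p (v (fst z)) (v (snd z)) \<bar>u (fst z)\<bar> \<bar>u (snd z)\<bar> * (1 / ?n z)"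
        by (rule tendsto_mult_right)
      then show "(\<lambda>n. P n z) \<longlonglongrightarrow> Pv z" by (simp add: P_def Pv_def)
    qed
  qed
  have Hlim: "AE x in lebesgue. x \<in> \<Omega> \<longrightarrow> (\<lambda>n. H n x) \<longlonglongrightarrow> Hv x"
    using upos \<psi>(3)
  proof eventually_elim
    case (elim x)
    show ?case
    proof
      assume x: "x \<in> \<Omega>"
      have ux: "0 < u x" using elim x by simp
      have "(\<lambda>n. \<bar>u x\<bar> / (\<bar>u x\<bar> + \<epsilon> n)) \<longlonglongrightarrow> \<bar>u x\<bar> / (\<bar>u x\<bar> + 0)"
        using ux by (intro tendsto_divide tendsto_add tendsto_const \<epsilon>0) auto
      then have "(\<lambda>n. \<bar>u x\<bar> / (\<bar>u x\<bar> + \<epsilon> n)) \<longlonglongrightarrow> 1" using ux by simp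
      then have 1: "(\<lambda>n. (\<bar>u x\<bar> / (\<bar>u x\<bar> + \<epsilon> n)) powr (p - 1)) \<longlonglongrightarrow> 1 powr (p - 1)"
        by (intro tendsto_powr tendsto_const) auto
      have 2: "(\<lambda>n. \<bar>\<psi> n x\<bar> powr p) \<longlonglongrightarrow> \<bar>v x\<bar> powr p"
        by (rule tendsto_powr'[OF tendsto_rabs[OF elim(2)] tendsto_const]) (use p in auto)
      have "0 < bdist \<Omega> x" by (rule bdist_pos[OF \<Omega> x])
      then have 3: "(\<lambda>n. \<bar>\<psi> n x\<bar> powr p / bdist \<Omega> x powr (s * p)) \<longlonglongrightarrow> \<bar>v x\<bar> powr p / bdist \<Omega> x powr (s * p)"
        by (intro tendsto_divide 2 tendsto_const) simp
      show "(\<lambda>n. H n x) \<longlonglongrightarrow> Hv x"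
        using tendsto_mult[OF 1 3] x by (simp add: H_def Hv_def)
    qed
  qed
  have bound: "(\<integral>\<^sup>+ z. ennreal (P n z) \<partial>lebesgue) + ennreal lam * (\<integral>\<^sup>+ x. ennreal (H n x) \<partial>lebesgue)
      \<le> ennreal lam + ennreal (\<epsilon> n)" for n
  proof -
    have "\<psi> n \<in> Cc_infinity \<Omega>" using \<psi>(1) by blast
    from supersolution_picone_inequality[OF p \<Omega> sup pos lam this \<epsilon>[of n]]
    have "(\<integral>\<^sup>+ z. ennreal (P n z) \<partial>lebesgue) + ennreal lam * (\<integral>\<^sup>+ x. ennreal (H n x) \<partial>lebesgue)
      \<le> gagliardo s p UNIV (\<psi> n)" unfolding P_def H_def .
    also have "\<dots> \<le> ennreal lam + ennreal (\<epsilon> n)" using \<psi>(2) v(3) by (simp add: \<epsilon>_def)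
    finally show ?thesis .
  qed
  let ?I = "\<integral>\<^sup>+ z. ennreal (Pv z) * indicator (\<Omega> \<times> \<Omega>) z \<partial>lebesgue"
  have FP: "?I \<le> liminf (\<lambda>n. \<integral>\<^sup>+ z. ennreal (P n z) \<partial>lebesgue)"
  proof -
    have "?I \<le> (\<integral>\<^sup>+ z. liminf (\<lambda>n. ennreal (P n z)) \<partial>lebesgue)"
    proof (rule nn_integral_mono_AE)
      show "AE z in lebesgue. ennreal (Pv z) * indicator (\<Omega> \<times> \<Omega>) z \<le> liminf (\<lambda>n. ennreal (P n z))"
        using Plim
      proof eventually_elim
        case (elim z)
        show ?case
        proof (cases "z \<in> \<Omega> \<times> \<Omega>")
          case True
          then have "(\<lambda>n. ennreal (P n z)) \<longlonglongrightarrow> ennreal (Pv z)" using elim by (intro tendsto_ennrealI) simp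
          then have "liminf (\<lambda>n. ennreal (P n z)) = ennreal (Pv z)"
            by (intro lim_imp_Liminf) simp_all
          then show ?thesis using True by simp
        qed simp
      qed
    qed
    also have "\<dots> \<le> liminf (\<lambda>n. \<integral>\<^sup>+ z. ennreal (P n z) \<partial>lebesgue)"
      by (rule nn_integral_liminf) measurable
    finally show ?thesis .
  qed
  have FH: "1 \<le> liminf (\<lambda>n. \<integral>\<^sup>+ x. ennreal (H n x) \<partial>lebesgue)"
  proof -
    have "1 = (\<integral>\<^sup>+ x. ennreal (Hv x) * indicator \<Omega> x \<partial>lebesgue)"
      using v(2) unfolding hardy_int_def Hv_def by simp
    also have "\<dots> \<le> (\<integral>\<^sup>+ x. liminf (\<lambda>n. ennreal (H n x)) \<partial>lebesgue)"
    proof (rule nn_integral_mono_AE)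
      show "AE x in lebesgue. ennreal (Hv x) * indicator \<Omega> x \<le> liminf (\<lambda>n. ennreal (H n x))"
        using Hlim
      proof eventually_elim
        case (elim x)
        show ?case
        proof (cases "x \<in> \<Omega>")
          case True
          then have "(\<lambda>n. ennreal (H n x)) \<longlonglongrightarrow> ennreal (Hv x)" using elim by (intro tendsto_ennrealI) simp
          then have "liminf (\<lambda>n. ennreal (H n x)) = ennreal (Hv x)"
            by (intro lim_imp_Liminf) simp_all
          then show ?thesis using True by simp
        qed simp
      qed
    qed
    also have "\<dots> \<le> liminf (\<lambda>n. \<integral>\<^sup>+ x. ennreal (H n x) \<partial>lebesgue)"
      by (rule nn_integral_liminf) measurable
    finally show ?thesis .
  qed
  have "?I = 0"
  proof (rule ccontr)
    assume "?I \<noteq> 0"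
    then have "0 < min ?I (ennreal lam)" using lam by (simp add: zero_less_iff_neq_zero)
    then obtain d where d: "0 < d" "d < min ?I (ennreal lam)" using dense by blast
    obtain \<delta> where \<delta>: "d = ennreal \<delta>" "0 \<le> \<delta>" using d(2) by (cases d) auto
    have \<delta>0: "0 < \<delta>" "\<delta> < lam" using d \<delta> by (auto simp: ennreal_less_iff)
    \<comment> \<open>With this \<open>\<eta>\<close> the two lower bounds add up to \<open>\<delta> + \<lambda> \<eta> = \<lambda> + \<delta>/2\<close>, which exceeds \<open>\<lambda> + \<epsilon>\<^sub>n\<close> for large \<open>n\<close>.\<close>
    define \<eta> where "\<eta> = 1 - \<delta> / (2 * lam)"
    have \<eta>: "0 \<le> \<eta>" "\<eta> < 1" "lam * \<eta> = lam - \<delta> / 2" using \<delta>0 by (simp_all add: \<eta>_def field_simps)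
    have "ennreal \<delta> < liminf (\<lambda>n. \<integral>\<^sup>+ z. ennreal (P n z) \<partial>lebesgue)"
      using d(2) unfolding \<delta>(1) by (intro less_le_trans[OF _ FP]) simp
    then have e1: "\<forall>\<^sub>F n in sequentially. ennreal \<delta> < (\<integral>\<^sup>+ z. ennreal (P n z) \<partial>lebesgue)"
      by (rule less_LiminfD)
    have "ennreal \<eta> < 1" using \<eta> by (simp add: ennreal_less_one_iff)
    then have "ennreal \<eta> < liminf (\<lambda>n. \<integral>\<^sup>+ x. ennreal (H n x) \<partial>lebesgue)"
      using FH by (rule less_le_trans)
    then have e2: "\<forall>\<^sub>F n in sequentially. ennreal \<eta> < (\<integral>\<^sup>+ x. ennreal (H n x) \<partial>lebesgue)"
      by (rule less_LiminfD)
    have e3: "\<forall>\<^sub>F n in sequentially. \<epsilon> n < \<delta> / 2" using \<epsilon>0 \<delta>0 by (intro order_tendstoD) auto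
    have "\<forall>\<^sub>F n in sequentially. False"
      using e1 e2 e3
    proof eventually_elim
      case (elim n)
      have "ennreal (\<delta> + lam * \<eta>) = ennreal \<delta> + ennreal lam * ennreal \<eta>"
        using ennreal_plus[of \<delta> "lam * \<eta>"] ennreal_mult[of lam \<eta>] \<delta>0 lam \<eta>(1) by simp
      also have "\<dots> \<le> (\<integral>\<^sup>+ z. ennreal (P n z) \<partial>lebesgue) + ennreal lam * (\<integral>\<^sup>+ x. ennreal (H n x) \<partial>lebesgue)"
        using elim lam by (intro add_mono mult_left_mono less_imp_le) auto
      also have "\<dots> \<le> ennreal (lam + \<epsilon> n)" using bound[of n] lam \<epsilon>[of n] by simp
      finally have "\<delta> + lam * \<eta> \<le> lam + \<epsilon> n" using lam \<epsilon>[of n] by (subst (asm) ennreal_le_iff) simp_all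
      then show False using elim(3) \<eta>(3) by simp
    qed
    then show False by simp
  qed
  then have "AE z in lebesgue. ennreal (Pv z) * indicator (\<Omega> \<times> \<Omega>) z = 0"
    by (subst (asm) nn_integral_0_iff_AE) measurable
  then show ?thesis
    using AE_lebesgue_fst[OF upos] AE_lebesgue_snd[OF upos]
  proof eventually_elim
    case (elim z)
    show ?case
    proof (rule impI, rule ccontr)
      assume z: "z \<in> \<Omega> \<times> \<Omega>" and ne: "\<bar>v (fst z)\<bar> * u (snd z) \<noteq> \<bar>v (snd z)\<bar> * u (fst z)"
      have ux: "0 < u (fst z)" "0 < u (snd z)" using elim(2,3) z by (auto simp: mem_Times_iff)
      have "fst z \<noteq> snd z" using ne by auto
      then have "0 < ?n z" by simp
      moreover have "0 < picone p (v (fst z)) (v (snd z)) \<bar>u (fst z)\<bar> \<bar>u (snd z)\<bar>"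
        using ne ux by (intro picone_pos[OF p(1)]) simp_all
      ultimately have "0 < Pv z" unfolding Pv_def by (rule divide_pos_pos[rotated])
      then show False using elim(1) z by simp
    qed
  qed
qed

text \<open>
  The function is constant, and the only \<open>p\<close>-integrable constant on the whole space is 0. This excludes
  \<open>\<lambda> = 0\<close>.
\<close>

lemma Wsp_gagliardo_zero_imp_zero:
  fixes v :: "'a::euclidean_space \<Rightarrow> real"
  assumes p: "1 < p" and v: "v \<in> Wsp s p UNIV" "gagliardo s p UNIV v = 0"
  shows "AE x in lebesgue. v x = 0"
proof -
  have vm [measurable]: "v \<in> borel_measurable lebesgue" and fin: "Lp_int p UNIV v < \<infinity>"
    using v(1) unfolding Wsp_def lebesgue_on_UNIV_eq by blast+
  have m: "(\<lambda>z. \<bar>v (fst z) - v (snd z)\<bar> powr p / norm (fst z - snd z :: 'a) powr (real DIM('a) + s * p)) \<in> borel_measurable lebesgue"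
    by (rule gagliardo_integrand_measurable[OF vm])
  have "AE z in lebesgue. ennreal (\<bar>v (fst z) - v (snd z)\<bar> powr p / norm (fst z - snd z :: 'a) powr (real DIM('a) + s * p)) = 0"
    using v(2) m unfolding gagliardo_UNIV by (subst (asm) nn_integral_0_iff_AE) measurable
  then have "AE z in lebesgue. z \<in> UNIV \<times> UNIV \<longrightarrow> v (fst z) = v (snd z)"
  proof eventually_elim
    case (elim z)
    show ?case
    proof (cases "fst z = snd z")
      case False
      then have "0 < norm (fst z - snd z) powr (real DIM('a) + s * p)" by simp
      then have "\<bar>v (fst z) - v (snd z)\<bar> powr p \<le> 0" using elim by (simp add: ennreal_eq_0_iff divide_le_0_iff)
      then show ?thesis by simp
    qed simp
  qed
  then obtain x where x: "AE y in lebesgue. y \<in> UNIV \<longrightarrow> v y = v x"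
    using ae_constant_from_pairs[of UNIV v] by auto
  have "Lp_int p UNIV v = (\<integral>\<^sup>+ y. ennreal (\<bar>v x\<bar> powr p) * indicator UNIV y \<partial>(lebesgue :: 'a measure))"
    unfolding Lp_int_def using x by (intro nn_integral_cong_AE) (auto elim!: eventually_mono)
  also have "\<dots> = ennreal (\<bar>v x\<bar> powr p) * emeasure (lebesgue :: 'a measure) UNIV"
    by (rule nn_integral_cmult_indicator) simp
  also have "\<dots> = ennreal (\<bar>v x\<bar> powr p) * \<infinity>" by simp
  finally have "\<bar>v x\<bar> powr p = 0" using fin by (auto simp: ennreal_mult_less_top)
  then show ?thesis using x by simp
qed

theorem proposition3p5:
  fixes \<Omega> :: "'a::euclidean_space set" and u :: "'a \<Rightarrow> real" and x\<^sub>0 :: 'a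
    and s p C :: real
  assumes "1 < p" and "0 < s" and "s < 1"
    and "open \<Omega>" and "\<Omega> \<noteq> UNIV"
    and "x\<^sub>0 \<in> frontier \<Omega>" and "locally_continuous_boundary_at \<Omega> x\<^sub>0"
    and "local_weak_supersolution s p (enn2real (hardy_const s p \<Omega>)) \<Omega> u"
    and "positive_on \<Omega> u"
    and "C > 0"
    and "AE x in lebesgue. x \<in> \<Omega> \<longrightarrow> u x \<ge> 1 / C * bdist \<Omega> x powr ((s * p - 1) / p)"
  shows "\<not> (\<exists>v \<in> Wsp_tilde0 s p \<Omega>. hardy_int s p \<Omega> v = 1 \<and>
             gagliardo s p UNIV v = hardy_const s p \<Omega>)"
proof
  assume "\<exists>v \<in> Wsp_tilde0 s p \<Omega>. hardy_int s p \<Omega> v = 1 \<and> gagliardo s p UNIV v = hardy_const s p \<Omega>"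
  then obtain v where v: "v \<in> Wsp_tilde0 s p \<Omega>" "hardy_int s p \<Omega> v = 1"
    "gagliardo s p UNIV v = hardy_const s p \<Omega>" by blast
  define lam where "lam = enn2real (hardy_const s p \<Omega>)"
  have vW: "v \<in> Wsp s p UNIV" using v(1) unfolding Wsp_tilde0_def by blast
  then have "gagliardo s p UNIV v < \<infinity>" unfolding Wsp_def by blast
  then have lam: "gagliardo s p UNIV v = ennreal lam" "0 \<le> lam" using v(3) by (simp_all add: lam_def)
  have fr: "frontier \<Omega> \<noteq> {}" using assms(6) by blast
  have \<Omega>m: "\<Omega> \<in> sets lebesgue" using assms(4) by simp
  have not0: "\<not> (AE x in lebesgue. x \<in> \<Omega> \<longrightarrow> v x = 0)"
  proof
    assume "AE x in lebesgue. x \<in> \<Omega> \<longrightarrow> v x = 0"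
    then have "hardy_int s p \<Omega> v = (\<integral>\<^sup>+ x. 0 \<partial>(lebesgue :: 'a measure))"
      unfolding hardy_int_def by (intro nn_integral_cong_AE) (auto elim!: eventually_mono simp: indicator_def)
    then show False using v(2) by simp
  qed
  have "0 < lam"
  proof (rule ccontr)
    assume "\<not> 0 < lam"
    then have "gagliardo s p UNIV v = 0" using lam by simp
    then have "AE x in lebesgue. v x = 0" by (rule Wsp_gagliardo_zero_imp_zero[OF assms(1) vW])
    then have "AE x in lebesgue. x \<in> \<Omega> \<longrightarrow> v x = 0" by (rule eventually_mono) simp
    then show False using not0 by blast
  qed
  have upos: "AE x in lebesgue. x \<in> \<Omega> \<longrightarrow> 0 < u x"
    using assms(9) unfolding positive_on_def by blast
  have "AE z in lebesgue. z \<in> \<Omega> \<times> \<Omega> \<longrightarrow> \<bar>v (fst z)\<bar> * u (snd z) = \<bar>v (snd z)\<bar> * u (fst z)"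
    by (rule minimiser_proportional_to_supersolution[OF assms(1-4) fr assms(8)[folded lam_def] assms(9)
          \<open>0 < lam\<close> v(1,2) lam(1)])
  then have "AE z in lebesgue. z \<in> \<Omega> \<times> \<Omega> \<longrightarrow> \<bar>v (fst z)\<bar> / u (fst z) = \<bar>v (snd z)\<bar> / u (snd z)"
    using AE_lebesgue_fst[OF upos] AE_lebesgue_snd[OF upos]
    by eventually_elim (auto simp: mem_Times_iff frac_eq_eq)
  moreover have "emeasure lebesgue \<Omega> \<noteq> 0"
  proof
    assume "emeasure lebesgue \<Omega> = 0"
    then have "negligible \<Omega>" using \<Omega>m by (simp add: negligible_iff_null_sets null_sets_def)
    then have "\<Omega> = {}" using open_not_negligible[OF assms(4)] by blast
    then show False using fr by simp
  qed
  ultimately obtain x where x: "AE y in lebesgue. y \<in> \<Omega> \<longrightarrow> \<bar>v y\<bar> / u y = \<bar>v x\<bar> / u x"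
    using ae_constant_from_pairs[of \<Omega> "\<lambda>x. \<bar>v x\<bar> / u x"] \<Omega>m by blast
  \<comment> \<open>The supersolution is positive only almost everywhere, so the chosen \<open>x\<close> may have \<open>u x \<le> 0\<close>; the outer
    absolute value makes \<open>k \<ge> 0\<close> without excluding this.\<close>
  define k where "k = \<bar>\<bar>v x\<bar> / u x\<bar>"
  have vk: "AE y in lebesgue. y \<in> \<Omega> \<longrightarrow> \<bar>v y\<bar> = k * u y"
    using x upos
  proof eventually_elim
    case (elim y)
    show ?case
    proof
      assume y: "y \<in> \<Omega>"
      then have uy: "0 < u y" and e: "\<bar>v y\<bar> / u y = \<bar>v x\<bar> / u x" using elim by simp_all
      have "k = \<bar>v y\<bar> / u y" unfolding k_def e[symmetric] using uy by simp
      then show "\<bar>v y\<bar> = k * u y" using uy by simp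
    qed
  qed
  have k: "0 < k"
  proof (rule ccontr)
    assume "\<not> 0 < k"
    moreover have "0 \<le> k" by (simp add: k_def)
    ultimately have "k = 0" by linarith
    then have "AE y in lebesgue. y \<in> \<Omega> \<longrightarrow> v y = 0" using vk by simp
    then show False using not0 by blast
  qed
  let ?c = "(k / C) powr p"
  have c: "0 < ?c" using k assms(10) by simp
  have "(\<integral>\<^sup>+ y. ennreal ?c * (ennreal (1 / bdist \<Omega> y) * indicator \<Omega> y) \<partial>lebesgue) \<le> hardy_int s p \<Omega> v"
    unfolding hardy_int_def
  proof (rule nn_integral_mono_AE)
    show "AE y in lebesgue. ennreal ?c * (ennreal (1 / bdist \<Omega> y) * indicator \<Omega> y)
       \<le> ennreal (\<bar>v y\<bar> powr p / bdist \<Omega> y powr (s * p)) * indicator \<Omega> y"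
      using vk assms(11)
    proof eventually_elim
      case (elim y)
      show ?case
      proof (cases "y \<in> \<Omega>")
        case True
        let ?d = "bdist \<Omega> y"
        have d: "0 < ?d" by (rule bdist_pos[OF assms(4) fr True])
        have "k / C * ?d powr ((s * p - 1) / p) \<le> \<bar>v y\<bar>"
          using elim True k mult_left_mono[of "1 / C * ?d powr ((s * p - 1) / p)" "u y" k] by simp
        then have "(k / C * ?d powr ((s * p - 1) / p)) powr p \<le> \<bar>v y\<bar> powr p"
          using k assms(1,10) by (intro powr_mono2) auto
        moreover have "(k / C * ?d powr ((s * p - 1) / p)) powr p = ?c * ?d powr (s * p - 1)"
          unfolding powr_mult powr_powr using assms(1) by simp
        ultimately have "?c * ?d powr (s * p - 1) / ?d powr (s * p) \<le> \<bar>v y\<bar> powr p / ?d powr (s * p)"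
          by (intro divide_right_mono) auto
        moreover have "?c * ?d powr (s * p - 1) / ?d powr (s * p) = ?c * (1 / ?d)"
          using d by (simp add: powr_diff)
        ultimately have "ennreal (?c * (1 / ?d)) \<le> ennreal (\<bar>v y\<bar> powr p / ?d powr (s * p))"
          by (intro ennreal_leI) simp
        moreover have "ennreal (?c * (1 / ?d)) = ennreal ?c * ennreal (1 / ?d)"
          by (rule ennreal_mult') simp
        ultimately have "ennreal ?c * ennreal (1 / ?d) \<le> ennreal (\<bar>v y\<bar> powr p / ?d powr (s * p))"
          by (simp only:)
        then show ?thesis using True by simp
      qed simp
    qed
  qed
  moreover have "(\<integral>\<^sup>+ y. ennreal ?c * (ennreal (1 / bdist \<Omega> y) * indicator \<Omega> y) \<partial>lebesgue) = \<infinity>"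
  proof -
    have [measurable]: "bdist \<Omega> \<in> borel_measurable lborel" using bdist_borel by simp
    have [measurable]: "\<Omega> \<in> sets borel" using assms(4) by simp
    have "(\<integral>\<^sup>+ y. ennreal ?c * (ennreal (1 / bdist \<Omega> y) * indicator \<Omega> y) \<partial>lebesgue)
       = ennreal ?c * (\<integral>\<^sup>+ y. ennreal (1 / bdist \<Omega> y) * indicator \<Omega> y \<partial>lborel)"
      unfolding nn_integral_completion by (rule nn_integral_cmult) measurable
    also have "\<dots> = ennreal ?c * \<infinity>"
      unfolding nn_integral_reciprocal_bdist_infinite[OF assms(4,6,7)] ..
    also have "\<dots> = \<infinity>" using c by (simp add: ennreal_mult_top)
    finally show ?thesis .
  qed
  ultimately show False using v(2) by (simp add: top_unique)
qed

end
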